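(* Let $\{X_t\}_{t\in\mathbb Z}$ be a real-valued stationary ergodic time series with distribution $P$. Let $\{\mathcal B_k\}_{k\ge1}$ be an increasing sequence of finite subfields, generated by intervals, that asymptotically generate the Borel $\sigma$-field of $\mathbb R$, let $\Xi_k$ denote the set of atoms of $\mathcal B_k$, and let $\{\ell_k\}_{k\ge1}$ and $\{J_k\}_{k\ge1}$ be nondecreasing unbounded sequences of positive integers. Choose a nondecreasing unbounded sequence of positive integers $k(n)$ and numbers $\varepsilon_k>0$ with $\varepsilon_k\to0$ such that $$n\ \ge\ \ell_{k(n)}+J_{k(n)}\,|\Xi_{k(n)}|^{\ell_{k(n)}}/\varepsilon_{k(n)}\quad\text{for all sufficiently large }n.$$ Then, with $\lambda_k$ and $\hat P(dx\mid X^{-n})$ as defined in the context, $P\{n\ge\lambda_{k(n)}\}\to1$ as $n\to\infty$, and the estimates $\hat P(dx\mid X^{-n})$ are weakly consistent: for every set $B\in\bigcup_k\mathcal B_k$, $$\hat P\{X_0\in B\mid X^{-n}\}\to P\{X_0\in B\mid X^-\}\quad\text{in }L^1(P),$$ and for every bounded continuous function $h:\mathbb R\to\mathbb R$, $$\int h(x)\,\hat P(dx\mid X^{-n})\to\int h(x)\,P(dx\mid X^-)\quad\text{in }L^1(P).$$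
   Context: Notation: $X=X_0$; $X^-=(\ldots,X_{-2},X_{-1})$; $X^{-n}=(X_{-n},\ldots,X_{-1})$; $P(dx\mid X^-)$ is the regular conditional distribution of $X_0$ given $X^-$. "Asymptotically generate" means that $\sigma\big(\bigcup_k\mathcal B_k\big)$ is the Borel $\sigma$-field. For $x\in\mathbb R$, $[x]^k$ is the atom of $\mathcal B_k$ containing $x$. Past recurrence times: $\tau^k_0=0$ and, for $j\ge1$, $$\tau^k_j=\min\{t>\tau^k_{j-1}:\ ([X_{-\ell_k-t}]^k,\ldots,[X_{-1-t}]^k)=([X_{-\ell_k}]^k,\ldots,[X_{-1}]^k)\}.$$ Put $\lambda_k=\ell_k+\tau^k_{J_k}$ and $\hat P_k(dx\mid X^{-\lambda_k})=\frac1{J_k}\sum_{1\le j\le J_k}\delta_{X_{-\tau^k_j}}(dx)$, with $\delta_\xi$ the unit point mass at $\xi$. Let $Q(dx)$ be a fixed default probability measure on $\mathbb R$. The truncated estimates are $$\hat P(dx\mid X^{-n})=\begin{cases}\hat P_{k(n)}(dx\mid X^{-\lambda_{k(n)}})&\text{if }\lambda_{k(n)}\le n,\\ Q(dx)&\text{otherwise.}\end{cases}$$ *)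

theory Defs
  imports "HOL-Probability.Probability" "HOL-Library.Extended_Nat"
begin

text \<open>A time series is a map \<open>X :: int \<Rightarrow> 'a \<Rightarrow> real\<close> on a probability space \<open>M\<close>; its law is
  a measure on the two-sided path space.\<close>

abbreviation path_space :: "(int \<Rightarrow> real) measure" where
  "path_space \<equiv> Pi\<^sub>M UNIV (\<lambda>_. borel)"

definition law :: "'a measure \<Rightarrow> (int \<Rightarrow> 'a \<Rightarrow> real) \<Rightarrow> (int \<Rightarrow> real) measure" where
  "law M X = distr M path_space (\<lambda>\<omega> t. X t \<omega>)"

definition stationary :: "'a measure \<Rightarrow> (int \<Rightarrow> 'a \<Rightarrow> real) \<Rightarrow> bool" where
  "stationary M X \<longleftrightarrow> law M (\<lambda>t. X (t + 1)) = law M X"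

definition ergodic :: "'a measure \<Rightarrow> (int \<Rightarrow> 'a \<Rightarrow> real) \<Rightarrow> bool" where
  "ergodic M X \<longleftrightarrow>
     (\<forall>A\<in>sets path_space. (\<lambda>x t. x (t + 1)) -` A = A \<longrightarrow>
        measure (law M X) A = 0 \<or> measure (law M X) A = 1)"

definition stationary_ergodic :: "'a measure \<Rightarrow> (int \<Rightarrow> 'a \<Rightarrow> real) \<Rightarrow> bool" where
  "stationary_ergodic M X \<longleftrightarrow>
     prob_space M \<and> (\<forall>t. X t \<in> borel_measurable M) \<and> stationary M X \<and> ergodic M X"

definition past_algebra :: "'a measure \<Rightarrow> (int \<Rightarrow> 'a \<Rightarrow> real) \<Rightarrow> 'a measure" where
  "past_algebra M X =
     vimage_algebra (space M) (\<lambda>\<omega>. \<lambda>t\<in>{..<0}. X t \<omega>) (Pi\<^sub>M {..<0} (\<lambda>_. borel))"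

definition regular_cond_distr ::
    "'a measure \<Rightarrow> 'a measure \<Rightarrow> ('a \<Rightarrow> real) \<Rightarrow> ('a \<Rightarrow> real measure) \<Rightarrow> bool" where
  "regular_cond_distr M F Y K \<longleftrightarrow>
     K \<in> F \<rightarrow>\<^sub>M prob_algebra borel \<and>
     (\<forall>B\<in>sets borel. AE \<omega> in M. measure (K \<omega>) B = real_cond_exp M F (\<lambda>\<omega>. indicator B (Y \<omega>)) \<omega>)"

text \<open>As the field is finite, it does not matter that the generated \<open>\<sigma>\<close>-field is used.\<close>

definition finite_interval_field :: "real set set \<Rightarrow> bool" where
  "finite_interval_field F \<longleftrightarrow>
     finite F \<and> (\<exists>G. (\<forall>I\<in>G. is_interval I) \<and> F = sigma_sets UNIV G)"

definition atoms :: "'b set set \<Rightarrow> 'b set set" where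
  "atoms F = {A \<in> F. A \<noteq> {} \<and> (\<forall>C\<in>F. C \<subseteq> A \<longrightarrow> C = {} \<or> C = A)}"

definition atom_of :: "'b set set \<Rightarrow> 'b \<Rightarrow> 'b set" where
  "atom_of F x = (THE A. A \<in> atoms F \<and> x \<in> A)"

text \<open>Everything below is a function of a sample path \<open>x :: int \<Rightarrow> real\<close>, for a field \<open>F\<close>, a block
  length \<open>l\<close> and a sample size \<open>m\<close>. A recurrence time is \<open>\<infinity>\<close> if the block does not recur often
  enough (\<open>Inf {} = \<infinity>\<close> on \<^typ>\<open>enat\<close>).\<close>

definition block_recurs :: "real set set \<Rightarrow> nat \<Rightarrow> (int \<Rightarrow> real) \<Rightarrow> nat \<Rightarrow> bool" where
  "block_recurs F l x t \<longleftrightarrow>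
     (\<forall>i\<in>{1..l}. atom_of F (x (- int i - int t)) = atom_of F (x (- int i)))"

primrec recurrence_time :: "real set set \<Rightarrow> nat \<Rightarrow> (int \<Rightarrow> real) \<Rightarrow> nat \<Rightarrow> enat" where
  "recurrence_time F l x 0 = 0"
| "recurrence_time F l x (Suc j) =
     Inf {enat t | t. recurrence_time F l x j < enat t \<and> block_recurs F l x t}"

definition memory_length :: "real set set \<Rightarrow> nat \<Rightarrow> nat \<Rightarrow> (int \<Rightarrow> real) \<Rightarrow> enat" where
  "memory_length F l m x = enat l + recurrence_time F l x m"

definition empirical_distr :: "nat \<Rightarrow> (nat \<Rightarrow> real) \<Rightarrow> real measure" where
  "empirical_distr m \<xi> = distr (uniform_count_measure {1..m}) borel \<xi>"

lemma emeasure_empirical_distr: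
  assumes "m > 0" "B \<in> sets borel"
  shows "emeasure (empirical_distr m \<xi>) B = (\<Sum>j=1..m. emeasure (return borel (\<xi> j)) B) / of_nat m"
proof -
  have "emeasure (empirical_distr m \<xi>) B = emeasure (uniform_count_measure {1..m}) ({1..m} \<inter> \<xi> -` B)"
    using assms(2) unfolding empirical_distr_def
    by (subst emeasure_distr)
      (auto simp: space_uniform_count_measure sets_uniform_count_measure measurable_def Int_commute)
  also have "\<dots> = of_nat (card ({1..m} \<inter> \<xi> -` B)) / of_nat m"
    using assms(1) by (subst emeasure_uniform_count_measure)
      (simp_all add: divide_ennreal[symmetric] ennreal_of_nat_eq_real_of_nat)
  also have "of_nat (card ({1..m} \<inter> \<xi> -` B)) = (\<Sum>j\<in>{1..m} \<inter> \<xi> -` B. 1 :: ennreal)"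
    by simp
  also have "\<dots> = (\<Sum>j=1..m. if j \<in> \<xi> -` B then 1 else 0)"
    by (rule sum.inter_restrict) simp
  also have "\<dots> = (\<Sum>j=1..m. emeasure (return borel (\<xi> j)) B)"
    by (rule sum.cong) (use assms(2) in simp_all)
  finally show ?thesis .
qed

text \<open>\<^const>\<open>the_enat\<close> is applied to an infinite time only where \<^const>\<open>memory_length\<close> is infinite,
  in which case the truncated estimate ignores the value.\<close>

definition recurrence_estimate :: "real set set \<Rightarrow> nat \<Rightarrow> nat \<Rightarrow> (int \<Rightarrow> real) \<Rightarrow> real measure" where
  "recurrence_estimate F l m x =
     empirical_distr m (\<lambda>j. x (- int (the_enat (recurrence_time F l x j))))"

definition truncated_estimate ::
    "(nat \<Rightarrow> real set set) \<Rightarrow> (nat \<Rightarrow> nat) \<Rightarrow> (nat \<Rightarrow> nat) \<Rightarrow> (nat \<Rightarrow> nat) \<Rightarrow> real measure \<Rightarrow>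
     nat \<Rightarrow> (int \<Rightarrow> real) \<Rightarrow> real measure" where
  "truncated_estimate \<B> l J k Q n x =
     (if memory_length (\<B> (k n)) (l (k n)) (J (k n)) x \<le> enat n
      then recurrence_estimate (\<B> (k n)) (l (k n)) (J (k n)) x
      else Q)"

text \<open>Integrability is required explicitly, since the Bochner integral of a non-integrable function
  is 0.\<close>

definition tendsto_L1 :: "'a measure \<Rightarrow> (nat \<Rightarrow> 'a \<Rightarrow> real) \<Rightarrow> ('a \<Rightarrow> real) \<Rightarrow> bool" where
  "tendsto_L1 M f g \<longleftrightarrow>
     (\<forall>n. integrable M (f n)) \<and> integrable M g \<and>
     (\<lambda>n. \<integral>\<omega>. \<bar>f n \<omega> - g \<omega>\<bar> \<partial>M) \<longlonglongrightarrow> 0"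

end

theory Submission
  imports Defs
begin

text \<open>Write \<open>S\<^sub>j x\<close> for the path \<open>x\<close> moved back to its \<open>j\<close>-th recurrence time, so that the estimate
integrates a test function \<open>\<phi>\<close> to \<open>(\<Sum>j=1..J. \<phi> (S\<^sub>j x at time 0)) / J\<close>, and let \<open>g\<close> be the
conditional expectation of \<open>\<phi>(X\<^sub>0)\<close> given the past. The central fact is
(\<open>distr_jump\<close>): each \<open>S\<^sub>j\<close> preserves the law of the process. If \<open>S\<^sub>j\<close> moves \<open>x\<close> back by
\<open>t\<close> to \<open>y\<close>, then seen from \<open>y\<close> the \<open>j\<close>-th recurrence in the \<^emph>\<open>forward\<close> direction occurs after
the same time \<open>t\<close>, because having the same block is an equivalence relation
(\<open>return_time_reversal\<close>). Summing over \<open>t\<close> and using stationarity gives the invariance, provided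
that the recurrence times are finite almost surely; this follows from Kac's inequality.

Three estimates follow. First, \<open>\<phi>(x\<^sub>0) - g(x)\<close> composed with \<open>S\<^sub>m\<close> (\<open>m \<ge> 1\<close>) only depends on
the past, hence is orthogonal to \<open>\<phi>(x\<^sub>0) - g(x)\<close>; by invariance the innovations along
\<open>S\<^sub>1 x, S\<^sub>2 x, \<dots>\<close> are pairwise orthogonal and their average is \<open>O(1/\<surd>J)\<close> in mean
(\<open>integral_abs_average_jump_le\<close>). Second, any function \<open>h\<close> of the current block takes the same
value at \<open>x\<close> and at all \<open>S\<^sub>j x\<close>, so by invariance the average of \<open>g\<close> along the \<open>S\<^sub>j x\<close>
differs from \<open>g x\<close> by at most \<open>2 E\<bar>g - h\<bar>\<close> in mean. This is small for large \<open>k\<close>: functions of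
the \<open>k\<close>-th block, \<open>k \<rightarrow> \<infinity>\<close>, are dense in \<open>L\<^sup>1\<close> of the past (\<open>approximation_by_labels\<close>), and a
function of a block at one stage is a function of the blocks at all later stages. Third, Kac's
inequality bounds the mean first recurrence time by the number of possible blocks, so the mean of
the \<open>J\<close>-th one is at most \<open>J |\<Xi>|\<^sup>l\<close> (\<open>nn_integral_return_time_le\<close>), and Markov's inequality bounds
the probability that the memory length exceeds \<open>n\<close> by \<open>\<epsilon>\<^bsub>k(n)\<^esub>\<close>.

All of this works for every bounded Borel function \<open>\<phi>\<close>; indicators of sets in the fields \<open>\<B>\<^sub>k\<close> and
bounded continuous functions are special cases. The argument is carried out on path space and transported to the
process at the end, where \<open>g\<close> evaluated along the process is identified with \<open>\<integral>\<phi> dK\<close>.\<close>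

section \<open>Successive hitting times of a predicate on the natural numbers\<close>

primrec nth_hit :: "(nat \<Rightarrow> bool) \<Rightarrow> nat \<Rightarrow> enat" where
  "nth_hit P 0 = 0"
| "nth_hit P (Suc j) = Inf {enat t | t. nth_hit P j < enat t \<and> P t}"

lemma recurrence_time_eq_nth_hit: "recurrence_time F l x j = nth_hit (block_recurs F l x) j"
  by (induction j) simp_all

lemma nth_hit_Suc_eq_enat_iff:
  "nth_hit P (Suc j) = enat t \<longleftrightarrow>
     nth_hit P j < enat t \<and> P t \<and> (\<forall>s<t. nth_hit P j < enat s \<longrightarrow> \<not> P s)"
    (is "?L \<longleftrightarrow> ?R")
proof
  let ?S = "{enat t | t. nth_hit P j < enat t \<and> P t}"
  assume L: ?L
  then have "Inf ?S = enat t" by simp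
  then have "?S \<noteq> {}"
    by (intro notI) (simp only: Inf_empty top_enat_def enat.distinct)
  then obtain u where "u \<in> ?S" by blast
  then have "Inf ?S \<in> ?S" by (rule wellorder_InfI)
  with \<open>Inf ?S = enat t\<close> have "enat t \<in> ?S" by (simp only:)
  then have 1: "nth_hit P j < enat t \<and> P t" by blast
  have "\<not> (nth_hit P j < enat s \<and> P s)" if "s < t" for s
  proof
    assume "nth_hit P j < enat s \<and> P s"
    then have "Inf ?S \<le> enat s" by (intro Inf_lower) blast
    with \<open>Inf ?S = enat t\<close> that show False by simp
  qed
  with 1 show ?R by blast
next
  assume R: ?R
  then show ?L
    unfolding nth_hit.simps
  proof (intro Inf_eqI)
    fix u assume "u \<in> {enat t | t. nth_hit P j < enat t \<and> P t}"
    then obtain s where "u = enat s" "nth_hit P j < enat s" "P s" by blast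
    with R show "enat t \<le> u" by (metis enat_ord_simps(1) not_le)
  qed blast
qed

text \<open>Counting the hits in \<open>{1..t}\<close> replaces the recursion. Measurability, additivity and time reversal
of return times all reduce to this one description.\<close>

lemma nth_hit_eq_enat_iff:
  "nth_hit P j = enat t \<longleftrightarrow> (t = 0 \<or> P t) \<and> card {s\<in>{1..t}. P s} = j"
proof (induction j arbitrary: t)
  case 0
  show ?case
    by (auto simp: zero_enat_def)
next
  case (Suc j)
  have card_Suc: "card {s\<in>{1..t}. P s} = Suc (card {s\<in>{1..t-1}. P s})" if "t > 0" "P t"
  proof -
    have "{s\<in>{1..t}. P s} = insert t {s\<in>{1..t-1}. P s}" using that by auto
    then show ?thesis using that by simp
  qed
  have card_gap: "card {s\<in>{1..t-1}. P s} = card {s\<in>{1..r}. P s}"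
    if "r < t" "\<forall>s<t. r < s \<longrightarrow> \<not> P s" for r
  proof -
    have "s \<le> t - 1 \<and> P s \<longleftrightarrow> s \<le> r \<and> P s" for s
      using that by (cases "s \<le> r") auto
    then have "{s\<in>{1..t-1}. P s} = {s\<in>{1..r}. P s}" by auto
    then show ?thesis by simp
  qed
  show ?case
  proof
    assume "nth_hit P (Suc j) = enat t"
    then have *: "nth_hit P j < enat t" "P t" "\<forall>s<t. nth_hit P j < enat s \<longrightarrow> \<not> P s"
      unfolding nth_hit_Suc_eq_enat_iff by blast+
    then obtain r where r: "nth_hit P j = enat r" using enat_iless by blast
    with * have rt: "r < t" "\<forall>s<t. r < s \<longrightarrow> \<not> P s" by simp_all
    have "card {s\<in>{1..r}. P s} = j" using r Suc.IH[of r] by blast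
    then have "card {s\<in>{1..t}. P s} = Suc j"
      using card_Suc[OF _ \<open>P t\<close>] card_gap[OF rt] rt(1) by linarith
    then show "(t = 0 \<or> P t) \<and> card {s\<in>{1..t}. P s} = Suc j"
      using \<open>P t\<close> by blast
  next
    assume A: "(t = 0 \<or> P t) \<and> card {s\<in>{1..t}. P s} = Suc j"
    then have t: "t > 0" "P t" by (cases t; auto)+
    with A have c: "card {s\<in>{1..t-1}. P s} = j" using card_Suc by simp
    define r where "r = Max (insert 0 {s\<in>{1..t-1}. P s})"
    have r_mem: "r \<in> insert 0 {s\<in>{1..t-1}. P s}" unfolding r_def by (intro Max_in) auto
    have r_max: "s \<le> r" if "P s" "s \<ge> 1" "s < t" for s
      unfolding r_def using that by (intro Max_ge) auto
    have rt: "r < t" using r_mem t by auto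
    have gap: "\<forall>s<t. r < s \<longrightarrow> \<not> P s" using r_max by fastforce
    have "nth_hit P j = enat r"
      unfolding Suc.IH using card_gap[OF rt gap] c r_mem by auto
    then show "nth_hit P (Suc j) = enat t"
      using t rt gap unfolding nth_hit_Suc_eq_enat_iff by auto
  qed
qed

text \<open>After the \<open>i\<close>-th hit the search starts afresh; this is the source of the cocycle identity
\<open>return_time_add\<close>.\<close>

lemma nth_hit_add:
  assumes "nth_hit P i = enat t"
  shows "nth_hit P (i + m) = enat t + nth_hit (\<lambda>s. P (t + s)) m"
proof -
  have split: "{s\<in>{1..t+u}. P s} = {s\<in>{1..t}. P s} \<union> (+) t ` {s\<in>{1..u}. P (t + s)}" for u
  proof (intro set_eqI iffI)
    fix s assume s: "s \<in> {s\<in>{1..t+u}. P s}"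
    show "s \<in> {s\<in>{1..t}. P s} \<union> (+) t ` {s\<in>{1..u}. P (t + s)}"
    proof (cases "s \<le> t")
      case False
      then have "s = t + (s - t)" "s - t \<in> {s\<in>{1..u}. P (t + s)}" using s by auto
      then have "s \<in> (+) t ` {s\<in>{1..u}. P (t + s)}" by (rule image_eqI)
      then show ?thesis by (rule UnI2)
    qed (use s in simp)
  next
    fix s assume "s \<in> {s\<in>{1..t}. P s} \<union> (+) t ` {s\<in>{1..u}. P (t + s)}"
    then show "s \<in> {s\<in>{1..t+u}. P s}" by (elim UnE imageE) simp_all
  qed
  have card: "card {s\<in>{1..t+u}. P s} = i + card {s\<in>{1..u}. P (t + s)}" for u
  proof -
    have "card {s\<in>{1..t+u}. P s} = card {s\<in>{1..t}. P s} + card ((+) t ` {s\<in>{1..u}. P (t + s)})"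
      unfolding split by (intro card_Un_disjoint) auto
    then show ?thesis
      using assms by (simp add: nth_hit_eq_enat_iff card_image)
  qed
  have key: "nth_hit P (i + m) = enat (t + u) \<longleftrightarrow> nth_hit (\<lambda>s. P (t + s)) m = enat u" for u
  proof (cases "u = 0")
    case False
    then show ?thesis unfolding nth_hit_eq_enat_iff card by simp
  next
    case True
    have "t = 0 \<or> P t" using assms unfolding nth_hit_eq_enat_iff by blast
    with True show ?thesis unfolding nth_hit_eq_enat_iff card by simp
  qed
  show ?thesis
  proof (cases "nth_hit (\<lambda>s. P (t + s)) m")
    case (enat u)
    then show ?thesis using key[of u] by simp
  next
    case infinity
    have "nth_hit P (i + m) \<noteq> enat v" for v
    proof
      assume v: "nth_hit P (i + m) = enat v"
      have "t \<le> v"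
      proof (rule ccontr)
        assume lt: "\<not> t \<le> v"
        have "t \<in> {s\<in>{1..t}. P s}" "t \<notin> {s\<in>{1..v}. P s}"
          using assms lt unfolding nth_hit_eq_enat_iff by simp_all
        moreover have "{s\<in>{1..v}. P s} \<subseteq> {s\<in>{1..t}. P s}"
          using lt by (intro Collect_mono) simp
        ultimately have "{s\<in>{1..v}. P s} \<subset> {s\<in>{1..t}. P s}" by blast
        then have "card {s\<in>{1..v}. P s} < card {s\<in>{1..t}. P s}"
          by (intro psubset_card_mono) auto
        then show False using v assms by (simp add: nth_hit_eq_enat_iff)
      qed
      then obtain u where "v = t + u" using le_Suc_ex by blast
      with v key[of u] infinity show False by simp
    qed
    then have "nth_hit P (i + m) = \<infinity>" by blast
    then show ?thesis using infinity by simp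
  qed
qed

section \<open>Return times of a stationary flow to the current label\<close>

lemma measurable_nth_hit:
  assumes [measurable]: "\<And>t. Measurable.pred M (\<lambda>x. P x t)"
  shows "(\<lambda>x. nth_hit (P x) j) \<in> M \<rightarrow>\<^sub>M count_space UNIV"
proof -
  have fin: "(\<lambda>x. nth_hit (P x) j) -` {enat t} \<inter> space M \<in> sets M" for t
  proof -
    have "(\<lambda>x. nth_hit (P x) j) -` {enat t} \<inter> space M =
        {x\<in>space M. (t = 0 \<or> P x t) \<and> card {s\<in>{1..t}. P x s} = j}"
      by (auto simp: nth_hit_eq_enat_iff)
    also have "\<dots> \<in> sets M" by measurable
    finally show ?thesis .
  qed
  have "(\<lambda>x. nth_hit (P x) j) -` {a} \<inter> space M \<in> sets M" for a
  proof (cases a)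
    case infinity
    have "(\<lambda>x. nth_hit (P x) j) -` {a} \<inter> space M =
        space M - (\<Union>t. (\<lambda>x. nth_hit (P x) j) -` {enat t} \<inter> space M)"
      using infinity by (auto simp: not_infinity_eq[symmetric] simp del: not_infinity_eq) 
    also have "\<dots> \<in> sets M" using fin by (intro sets.Diff sets.top sets.countable_UN) auto
    finally show ?thesis .
  qed (use fin in simp)
  then show ?thesis by (simp add: measurable_count_space_eq2_countable)
qed

lemma pred_eq_of_finite_range:
  assumes [measurable]: "f \<in> N \<rightarrow>\<^sub>M count_space UNIV" "g \<in> N \<rightarrow>\<^sub>M count_space UNIV"
    and "finite S" "\<And>x. f x \<in> S"
  shows "Measurable.pred N (\<lambda>x. f x = g x)"
proof -
  have "{x\<in>space N. f x = g x} = (\<Union>b\<in>S. (f -` {b} \<inter> space N) \<inter> (g -` {b} \<inter> space N))"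
    by auto (metis assms(4))
  also have "\<dots> \<in> sets N"
    by (intro sets.finite_UN assms sets.Int measurable_sets[where A="count_space UNIV"]) simp_all
  finally show ?thesis by (simp add: pred_def)
qed

text \<open>An invertible measure-preserving action of the integers. Invertibility is essential: recurrence
into the past is compared with recurrence into the future.\<close>

locale stationary_flow = prob_space +
  fixes T :: "int \<Rightarrow> 'a \<Rightarrow> 'a"
  assumes T_0: "T 0 x = x"
    and T_add: "T (s + t) x = T s (T t x)"
    and measurable_T [measurable]: "\<And>t. T t \<in> M \<rightarrow>\<^sub>M M"
    and distr_T: "\<And>t. distr M M (T t) = M"
begin

lemma nn_integral_T:
  assumes [measurable]: "f \<in> borel_measurable M"
  shows "(\<integral>\<^sup>+x. f (T t x) \<partial>M) = (\<integral>\<^sup>+x. f x \<partial>M)"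
  by (subst (2) distr_T[of t, symmetric]) (simp add: nn_integral_distr)

lemma emeasure_T:
  assumes "A \<in> sets M"
  shows "emeasure M {x\<in>space M. T t x \<in> A} = emeasure M A"
  by (subst (2) distr_T[of t, symmetric])
    (use assms in \<open>simp add: emeasure_distr vimage_def Int_def conj_commute\<close>)

end

text \<open>The label stands for the quantised block before time 0. There are only finitely many labels, which
is what makes mean return times finite.\<close>

locale labelled_flow = stationary_flow M T for M :: "'a measure" and T +
  fixes c :: "'a \<Rightarrow> 'b"
  assumes measurable_label [measurable]: "c \<in> M \<rightarrow>\<^sub>M count_space UNIV"
    and finite_labels: "finite (range c)"
begin

definition return_time :: "nat \<Rightarrow> 'a \<Rightarrow> enat" where
  "return_time j x = nth_hit (\<lambda>t. c (T (- int t) x) = c x) j"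

text \<open>The mirror image of \<open>return_time\<close>, which looks into the past. The comparison of the two shows
that jumps preserve the measure.\<close>

definition forward_return_time :: "nat \<Rightarrow> 'a \<Rightarrow> enat" where
  "forward_return_time j x = nth_hit (\<lambda>t. c (T (int t) x) = c x) j"

text \<open>On the null set where the return time is infinite, \<^const>\<open>the_enat\<close> picks an unspecified time.\<close>

definition jump :: "nat \<Rightarrow> 'a \<Rightarrow> 'a" where
  "jump j x = T (- int (the_enat (return_time j x))) x"

lemma pred_label_eq [measurable]:
  assumes [measurable]: "f \<in> N \<rightarrow>\<^sub>M M" "g \<in> N \<rightarrow>\<^sub>M M"
  shows "Measurable.pred N (\<lambda>x. c (f x) = c (g x))"
  by (rule pred_eq_of_finite_range[OF _ _ finite_labels]) auto

lemma measurable_return_time [measurable]: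
  "return_time j \<in> M \<rightarrow>\<^sub>M count_space UNIV"
  unfolding return_time_def by (rule measurable_nth_hit) measurable

lemma measurable_forward_return_time [measurable]:
  "forward_return_time j \<in> M \<rightarrow>\<^sub>M count_space UNIV"
  unfolding forward_return_time_def by (rule measurable_nth_hit) measurable

lemma measurable_jump [measurable]: "jump j \<in> M \<rightarrow>\<^sub>M M"
  unfolding jump_def
  by (rule measurable_compose_countable[where f="\<lambda>i x. T (- int (the_enat i)) x" and g="return_time j"]) measurable

lemma return_time_0 [simp]: "return_time 0 x = 0"
  by (simp add: return_time_def)

lemma label_jump:
  assumes "return_time j x \<noteq> \<infinity>"
  shows "c (jump j x) = c x"
proof -
  obtain t where t: "return_time j x = enat t" using assms by auto
  then have "t = 0 \<or> c (T (- int t) x) = c x"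
    unfolding return_time_def nth_hit_eq_enat_iff by blast
  then show ?thesis using t by (auto simp: jump_def T_0)
qed

lemma return_time_add:
  assumes "return_time i x \<noteq> \<infinity>"
  shows "return_time (i + m) x = return_time i x + return_time m (jump i x)"
proof -
  obtain t where t: "return_time i x = enat t" using assms by auto
  have c: "c (T (- int t) x) = c x"
    using label_jump[OF assms] by (simp add: jump_def t)
  have "T (- int (t + s)) x = T (- int s) (T (- int t) x)" for s
    using T_add[of "- int s" "- int t" x] by (simp add: algebra_simps)
  then show ?thesis
    using t nth_hit_add[of "\<lambda>t. c (T (- int t) x) = c x" i t m] c
    by (simp add: return_time_def jump_def)
qed

lemma jump_add:
  assumes "return_time i x \<noteq> \<infinity>" "return_time m (jump i x) \<noteq> \<infinity>"
  shows "jump (i + m) x = jump m (jump i x)"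
proof -
  obtain t where t: "return_time i x = enat t" using assms by auto
  obtain s where s: "return_time m (jump i x) = enat s" using assms by auto
  have "T (- int (t + s)) x = T (- int s) (T (- int t) x)"
    using T_add[of "- int s" "- int t" x] by (simp add: algebra_simps)
  then show ?thesis
    using s t return_time_add[OF assms(1), of m] by (simp add: jump_def)
qed

text \<open>Equality of labels is symmetric and transitive: if \<open>x\<close> and \<open>T t x\<close> have the same label, then the
times in between at which that label occurs are the same whether counted backwards from \<open>T t x\<close>
or forwards from \<open>x\<close>. The two counts differ only in which of the two end points they include.\<close>

lemma return_time_reversal:
  "return_time j (T (int t) x) = enat t \<longleftrightarrow> forward_return_time j x = enat t"
proof -
  let ?y = "T (int t) x"
  let ?P = "\<lambda>s. c (T (- int s) ?y) = c ?y" and ?R = "\<lambda>s. c (T (int s) x) = c x"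
  have T_y: "T (- int s) ?y = T (int (t - s)) x" if "s \<le> t" for s
    using T_add[of "- int s" "int t" x] that by (simp add: of_nat_diff)
  have "card {s\<in>{1..t}. ?P s} = card {s\<in>{1..t}. ?R s}" if "c ?y = c x"
  proof (cases "t = 0")
    case False
    let ?A = "{s\<in>{1..<t}. c (T (int s) x) = c x}"
    have "{s\<in>{1..t}. ?R s} = insert t ?A" using that False by auto
    moreover have "{s\<in>{1..t}. ?P s} = insert t ((\<lambda>s. t - s) ` ?A)"
    proof (intro set_eqI iffI)
      fix s assume s: "s \<in> {s\<in>{1..t}. ?P s}"
      show "s \<in> insert t ((\<lambda>s. t - s) ` ?A)"
      proof (cases "s = t")
        case False
        have "s = t - (t - s)" "t - s \<in> ?A" using s False T_y[of s] that by auto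
        then have "s \<in> (\<lambda>s. t - s) ` ?A" by (rule image_eqI)
        then show ?thesis by (rule insertI2)
      qed simp
    next
      fix s assume "s \<in> insert t ((\<lambda>s. t - s) ` ?A)"
      then show "s \<in> {s\<in>{1..t}. ?P s}"
      proof (elim insertE imageE)
        assume "s = t" then show ?thesis using T_y[of t] False that by (simp add: T_0)
      next
        fix r assume "s = t - r" "r \<in> ?A"
        then show ?thesis using T_y[of "t - r"] that by auto
      qed
    qed
    moreover have "t \<notin> (\<lambda>s. t - s) ` ?A" "t \<notin> ?A" by auto
    moreover have "card ((\<lambda>s. t - s) ` ?A) = card ?A"
      by (rule card_image) (auto intro!: inj_onI)
    ultimately show ?thesis by simp
  qed simp
  moreover have "?P t \<longleftrightarrow> ?R t" using T_y[of t] by (auto simp: T_0)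
  ultimately show ?thesis
    unfolding return_time_def forward_return_time_def nth_hit_eq_enat_iff
    by (cases "t = 0") (auto simp: T_0)
qed

text \<open>Split according to the value \<open>t\<close> of the return time and move the \<open>t\<close>-th part by \<open>T t\<close>: the
backward return at \<open>t\<close> turns into a forward return at \<open>t\<close>.\<close>

lemma nn_integral_jump:
  assumes [measurable]: "f \<in> borel_measurable M"
  shows "(\<integral>\<^sup>+x. f (jump j x) * indicator {x. return_time j x \<noteq> \<infinity>} x \<partial>M) =
         (\<integral>\<^sup>+x. f x * indicator {x. forward_return_time j x \<noteq> \<infinity>} x \<partial>M)"
proof -
  have split: "g x * indicator {x. \<tau> x \<noteq> \<infinity>} x = (\<Sum>t. g x * indicator {x. \<tau> x = enat t} x)"
    for g :: "'a \<Rightarrow> ennreal" and \<tau> :: "'a \<Rightarrow> enat" and x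
  proof (cases "\<tau> x")
    case (enat t)
    have "(\<Sum>s. g x * indicator {x. \<tau> x = enat s} x) = (\<Sum>s\<in>{t}. g x * indicator {x. \<tau> x = enat s} x)"
      using enat by (intro suminf_finite) auto
    then show ?thesis using enat by simp
  qed simp
  have "(\<integral>\<^sup>+x. f (jump j x) * indicator {x. return_time j x \<noteq> \<infinity>} x \<partial>M) =
      (\<integral>\<^sup>+x. (\<Sum>t. f (T (- int t) x) * indicator {x. return_time j x = enat t} x) \<partial>M)"
    by (subst split, intro nn_integral_cong suminf_cong) (auto simp: jump_def indicator_def)
  also have "\<dots> = (\<Sum>t. \<integral>\<^sup>+x. f (T (- int t) x) * indicator {x. return_time j x = enat t} x \<partial>M)"
    by (rule nn_integral_suminf) measurable
  also have "\<dots> = (\<Sum>t. \<integral>\<^sup>+x. f x * indicator {x. forward_return_time j x = enat t} x \<partial>M)"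
  proof (rule suminf_cong)
    fix t
    have TT: "T (- int t) (T (int t) x) = x" for x
      using T_add[of "- int t" "int t" x] by (simp add: T_0)
    have "(\<integral>\<^sup>+x. f (T (- int t) x) * indicator {x. return_time j x = enat t} x \<partial>M) =
        (\<integral>\<^sup>+x. f (T (- int t) (T (int t) x)) * indicator {x. return_time j x = enat t} (T (int t) x) \<partial>M)"
      by (rule nn_integral_T[symmetric]) measurable
    also have "\<dots> = (\<integral>\<^sup>+x. f x * indicator {x. forward_return_time j x = enat t} x \<partial>M)"
      by (intro nn_integral_cong) (auto simp: TT indicator_def return_time_reversal)
    finally show "(\<integral>\<^sup>+x. f (T (- int t) x) * indicator {x. return_time j x = enat t} x \<partial>M) =
        (\<integral>\<^sup>+x. f x * indicator {x. forward_return_time j x = enat t} x \<partial>M)" .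
  qed
  also have "\<dots> = (\<integral>\<^sup>+x. (\<Sum>t. f x * indicator {x. forward_return_time j x = enat t} x) \<partial>M)"
    by (rule nn_integral_suminf[symmetric]) measurable
  also have "\<dots> = (\<integral>\<^sup>+x. f x * indicator {x. forward_return_time j x \<noteq> \<infinity>} x \<partial>M)"
    by (subst split) simp
  finally show ?thesis .
qed

end

section \<open>Kac's inequality and invariance under jumps\<close>

context labelled_flow
begin

text \<open>The tail event of the first return time, in the form in which Kac's argument decomposes it.\<close>

lemma less_first_return_iff:
  "enat t < return_time (Suc 0) x \<longleftrightarrow> (\<forall>s\<in>{1..t}. c (T (- int s) x) \<noteq> c x)"
proof -
  let ?P = "\<lambda>s. c (T (- int s) x) = c x"
  show ?thesis
  proof
    assume L: "enat t < return_time (Suc 0) x"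
    show "\<forall>s\<in>{1..t}. \<not> ?P s"
    proof (intro ballI notI)
      fix s assume s: "s \<in> {1..t}" "?P s"
      have "return_time (Suc 0) x \<le> enat s"
        unfolding return_time_def nth_hit.simps
        by (intro Inf_lower) (use s in \<open>auto simp: zero_enat_def\<close>)
      then have "return_time (Suc 0) x \<le> enat t" using s(1)
        by (meson atLeastAtMost_iff enat_ord_simps(1) order_trans)
      with L show False by simp
    qed
  next
    assume R: "\<forall>s\<in>{1..t}. \<not> ?P s"
    have "enat (Suc t) \<le> return_time (Suc 0) x"
      unfolding return_time_def nth_hit.simps
    proof (rule Inf_greatest)
      fix u assume "u \<in> {enat t |t. 0 < enat t \<and> c (T (- int t) x) = c x}"
      then obtain s where s: "u = enat s" "s > 0" "?P s" by (auto simp: zero_enat_def)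
      have "\<not> s \<le> t"
      proof
        assume "s \<le> t"
        with s(2) have "s \<in> {1..t}" by simp
        with R s(3) show False by blast
      qed
      with s(1) show "enat (Suc t) \<le> u" by simp
    qed
    then show "enat t < return_time (Suc 0) x" by (simp add: Suc_ile_eq)
  qed
qed

lemma ennreal_of_enat_eq_suminf:
  "ennreal_of_enat n = (\<Sum>t. indicator {t. enat t < n} t)"
proof (cases n)
  case (enat m)
  have "(\<Sum>t. indicator {t. enat t < n} t :: ennreal) = (\<Sum>t<m. indicator {t. enat t < n} t)"
    using enat by (intro suminf_finite) auto
  also have "\<dots> = (\<Sum>t<m. 1)" using enat by (intro sum.cong) auto
  finally show ?thesis using enat by simp
next
  case infinity
  have "of_nat m \<le> (\<Sum>t. 1 :: ennreal)" for m :: nat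
    using sum_le_suminf[of "\<lambda>_. 1 :: ennreal" "{..<m}"] by simp
  then have "(\<Sum>t. 1 :: ennreal) = \<infinity>"
    using ennreal_Ex_less_of_nat by (metis infinity_ennreal_def not_le top.not_eq_extremum)
  then show ?thesis using infinity by simp
qed

text \<open>Kac's inequality. The integral is the sum over \<open>t\<close> of the probabilities of not having returned by
time \<open>t\<close>. For a fixed label \<open>b\<close>, stationarity turns the event "label \<open>b\<close> now, not in the last
\<open>t\<close> steps" into "first occurrence of \<open>b\<close> exactly at time \<open>t\<close>". These are disjoint, so each label
contributes at most 1.\<close>

lemma nn_integral_first_return_le:
  "(\<integral>\<^sup>+x. ennreal_of_enat (return_time (Suc 0) x) \<partial>M) \<le> of_nat (card (range c))"
proof -
  (* E: label b now but not in the last t steps; H: the label b occurs at t for the first time. *)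
  define E where "E b t = {x\<in>space M. c x = b \<and> (\<forall>s\<in>{1..t}. c (T (- int s) x) \<noteq> b)}" for b t
  define H where "H b t = {x\<in>space M. c (T (int t) x) = b \<and> (\<forall>s<t. c (T (int s) x) \<noteq> b)}" for b t
  have [measurable]: "Measurable.pred M (\<lambda>x. c (f x) = b)" if [measurable]: "f \<in> M \<rightarrow>\<^sub>M M" for f b
    by measurable
  have E_meas [measurable]: "E b t \<in> sets M" and H_meas [measurable]: "H b t \<in> sets M" for b t
    unfolding E_def H_def by measurable
  have EH: "emeasure M (E b t) = emeasure M (H b t)" for b t
  proof -
    have *: "T (- int s) (T (int t) x) = T (int (t - s)) x" if "s \<le> t" for s x
      using T_add[of "- int s" "int t" x] that by (simp add: of_nat_diff)
    have flip: "(\<forall>s\<in>{1..t}. c (T (int (t - s)) x) \<noteq> b) \<longleftrightarrow> (\<forall>s<t. c (T (int s) x) \<noteq> b)" for x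
    proof
      assume A: "\<forall>s\<in>{1..t}. c (T (int (t - s)) x) \<noteq> b"
      show "\<forall>s<t. c (T (int s) x) \<noteq> b"
      proof (intro allI impI)
        fix s assume "s < t"
        then show "c (T (int s) x) \<noteq> b" using A[rule_format, of "t - s"] by simp
      qed
    next
      assume A: "\<forall>s<t. c (T (int s) x) \<noteq> b"
      show "\<forall>s\<in>{1..t}. c (T (int (t - s)) x) \<noteq> b"
      proof
        fix s assume "s \<in> {1..t}"
        then have "t - s < t" by simp
        then show "c (T (int (t - s)) x) \<noteq> b" using A by blast
      qed
    qed
    have "{x\<in>space M. T (int t) x \<in> E b t} = H b t"
    proof (intro set_eqI)
      fix x
      have "(\<forall>s\<in>{1..t}. c (T (- int s) (T (int t) x)) \<noteq> b) \<longleftrightarrow> (\<forall>s<t. c (T (int s) x) \<noteq> b)"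
        unfolding flip[of x, symmetric] by (intro ball_cong refl) (simp only: * atLeastAtMost_iff)
      then show "x \<in> {x\<in>space M. T (int t) x \<in> E b t} \<longleftrightarrow> x \<in> H b t"
        unfolding E_def H_def using measurable_space[OF measurable_T[of "int t"], of x] by blast
    qed
    then show ?thesis using emeasure_T[OF E_meas, of "int t" b t] by simp
  qed
  have disj: "disjoint_family (H b)" for b
    unfolding disjoint_family_on_def
  proof (intro ballI impI)
    fix s t :: nat assume "s \<noteq> t"
    then show "H b s \<inter> H b t = {}"
      by (cases s t rule: linorder_cases) (auto simp: H_def)
  qed
  have sum_le: "(\<Sum>t. emeasure M (E b t)) \<le> 1" for b
  proof -
    have "(\<Sum>t. emeasure M (E b t)) = emeasure M (\<Union>t. H b t)"
      unfolding EH using disj by (intro suminf_emeasure) auto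
    also have "\<dots> \<le> 1" by (rule emeasure_le_1)
    finally show ?thesis .
  qed
  have "(\<integral>\<^sup>+x. ennreal_of_enat (return_time (Suc 0) x) \<partial>M) =
      (\<integral>\<^sup>+x. (\<Sum>t. \<Sum>b\<in>range c. indicator (E b t) x) \<partial>M)"
  proof (rule nn_integral_cong)
    fix x assume x: "x \<in> space M"
    have "indicator {t. enat t < return_time (Suc 0) x} t = (\<Sum>b\<in>range c. indicator (E b t) x :: ennreal)" for t
    proof -
      have "(\<Sum>b\<in>range c. indicator (E b t) x :: ennreal) = (\<Sum>b\<in>{c x}. indicator (E b t) x)"
        using finite_labels by (intro sum.mono_neutral_right) (auto simp: E_def indicator_def)
      then show ?thesis using x by (auto simp: less_first_return_iff E_def indicator_def)
    qed
    then show "ennreal_of_enat (return_time (Suc 0) x) = (\<Sum>t. \<Sum>b\<in>range c. indicator (E b t) x)"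
      by (simp add: ennreal_of_enat_eq_suminf)
  qed
  also have "\<dots> = (\<Sum>t. \<Sum>b\<in>range c. emeasure M (E b t))"
    by (subst nn_integral_suminf, measurable) (simp add: nn_integral_sum)
  also have "\<dots> = (\<Sum>b\<in>range c. \<Sum>t. emeasure M (E b t))"
    by (rule suminf_sum) simp
  also have "\<dots> \<le> (\<Sum>b\<in>range c. 1)" by (intro sum_mono sum_le)
  finally show ?thesis by simp
qed

lemma return_time_Suc:
  "return_time (Suc j) x = return_time j x + (if return_time j x = \<infinity> then 0 else return_time (Suc 0) (jump j x))"
proof (cases "return_time j x = \<infinity>")
  case True
  then have "return_time (Suc j) x = \<infinity>"
    unfolding return_time_def by (simp add: top_enat_def)
  then show ?thesis using True by simp
qed (use return_time_add[of j x "Suc 0"] in simp)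

text \<open>The \<open>Suc j\<close>-th return is the \<open>j\<close>-th one followed by a first return of the path jumped to.
Comparing the laws before and after the jump by \<open>nn_integral_jump\<close>, and dropping the indicator on
its right-hand side, avoids using invariance, which is only available once the return times are
known to be finite.\<close>

lemma nn_integral_return_time_le:
  "(\<integral>\<^sup>+x. ennreal_of_enat (return_time j x) \<partial>M) \<le> of_nat (j * card (range c))"
proof (induction j)
  case (Suc j)
  have "(\<integral>\<^sup>+x. ennreal_of_enat (return_time (Suc j) x) \<partial>M) =
     (\<integral>\<^sup>+x. ennreal_of_enat (return_time j x) +
        ennreal_of_enat (return_time (Suc 0) (jump j x)) * indicator {x. return_time j x \<noteq> \<infinity>} x \<partial>M)"
    by (intro nn_integral_cong) (subst return_time_Suc, simp)
  also have "\<dots> = (\<integral>\<^sup>+x. ennreal_of_enat (return_time j x) \<partial>M) +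
     (\<integral>\<^sup>+x. ennreal_of_enat (return_time (Suc 0) (jump j x)) * indicator {x. return_time j x \<noteq> \<infinity>} x \<partial>M)"
    by (rule nn_integral_add) measurable
  also have "(\<integral>\<^sup>+x. ennreal_of_enat (return_time (Suc 0) (jump j x)) * indicator {x. return_time j x \<noteq> \<infinity>} x \<partial>M) =
     (\<integral>\<^sup>+x. ennreal_of_enat (return_time (Suc 0) x) * indicator {x. forward_return_time j x \<noteq> \<infinity>} x \<partial>M)"
    by (rule nn_integral_jump) measurable
  also have "\<dots> \<le> (\<integral>\<^sup>+x. ennreal_of_enat (return_time (Suc 0) x) \<partial>M)"
    by (intro nn_integral_mono) (auto simp: indicator_def)
  also note nn_integral_first_return_le
  also note Suc.IH
  finally show ?case by (simp add: add.commute)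
qed simp

lemma AE_return_time_finite: "AE x in M. return_time j x \<noteq> \<infinity>"
proof -
  have "(\<integral>\<^sup>+x. ennreal_of_enat (return_time j x) \<partial>M) \<noteq> \<infinity>"
    using nn_integral_return_time_le[of j] ennreal_of_nat_neq_top[of "j * card (range c)"]
    by (metis infinity_ennreal_def top_unique)
  then have "AE x in M. ennreal_of_enat (return_time j x) \<noteq> \<infinity>"
    by (intro nn_integral_noteq_infinite) measurable
  then show ?thesis by eventually_elim (metis ennreal_of_enat_infty)
qed

text \<open>Apply \<open>nn_integral_jump\<close> to the constant function 1: finiteness in one direction gives
finiteness in the other.\<close>

lemma AE_forward_return_time_finite: "AE x in M. forward_return_time j x \<noteq> \<infinity>"
proof -
  have "emeasure M {x\<in>space M. forward_return_time j x \<noteq> \<infinity>} =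
      (\<integral>\<^sup>+x. 1 * indicator {x. forward_return_time j x \<noteq> \<infinity>} x \<partial>M)"
    unfolding mult_1
    by (subst nn_integral_indicator[symmetric], measurable)
      (intro nn_integral_cong, simp add: indicator_def)
  also have "\<dots> = (\<integral>\<^sup>+x. 1 * indicator {x. return_time j x \<noteq> \<infinity>} x \<partial>M)"
    by (rule nn_integral_jump[symmetric]) simp
  also have "\<dots> = (\<integral>\<^sup>+x. 1 \<partial>M)"
    using AE_return_time_finite[of j] by (intro nn_integral_cong_AE) (auto elim!: eventually_mono)
  finally have "emeasure M {x\<in>space M. forward_return_time j x \<noteq> \<infinity>} = 1"
    by (simp add: emeasure_space_1)
  then show ?thesis
    by (subst AE_iff_emeasure_eq_1) auto
qed

text \<open>As both return times are finite almost surely, the indicators in \<open>nn_integral_jump\<close> disappear.\<close>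

lemma distr_jump: "distr M M (jump j) = M"
proof (rule measure_eqI)
  fix A assume "A \<in> sets (distr M M (jump j))"
  then have [measurable]: "A \<in> sets M" by simp
  have "emeasure (distr M M (jump j)) A = (\<integral>\<^sup>+x. indicator A (jump j x) \<partial>M)"
    by (subst nn_integral_indicator[symmetric], simp, subst nn_integral_distr) auto
  also have "\<dots> = (\<integral>\<^sup>+x. indicator A (jump j x) * indicator {x. return_time j x \<noteq> \<infinity>} x \<partial>M)"
    using AE_return_time_finite[of j] by (intro nn_integral_cong_AE) (auto elim!: eventually_mono)
  also have "\<dots> = (\<integral>\<^sup>+x. indicator A x * indicator {x. forward_return_time j x \<noteq> \<infinity>} x \<partial>M)"
    by (rule nn_integral_jump) simp
  also have "\<dots> = (\<integral>\<^sup>+x. indicator A x \<partial>M)"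
    using AE_forward_return_time_finite[of j] by (intro nn_integral_cong_AE) (auto elim!: eventually_mono)
  finally show "emeasure (distr M M (jump j)) A = emeasure M A" by simp
qed simp

lemma integral_jump:
  fixes f :: "'a \<Rightarrow> real"
  assumes [measurable]: "f \<in> borel_measurable M"
  shows "(\<integral>x. f (jump j x) \<partial>M) = (\<integral>x. f x \<partial>M)"
  by (subst (2) distr_jump[of j, symmetric]) (simp add: integral_distr)

lemma integrable_jump:
  fixes f :: "'a \<Rightarrow> real"
  assumes "integrable M f"
  shows "integrable M (\<lambda>x. f (jump j x))"
  using assms by (intro integrable_distr[of "jump j" M M]) (simp_all add: distr_jump)

text \<open>Markov's inequality for the bound on the mean return time.\<close>

lemma prob_return_time_gt_le:
  assumes "r > 0"
  shows "prob {x\<in>space M. \<not> return_time j x \<le> enat r} \<le> real (j * card (range c)) / real r"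
proof -
  let ?u = "\<lambda>x. ennreal_of_enat (return_time j x)"
  have "emeasure M {x\<in>space M. \<not> return_time j x \<le> enat r} \<le> emeasure M {x\<in>space M. 1 \<le> ennreal (1 / r) * ?u x}"
  proof (rule emeasure_mono)
    show "{x \<in> space M. \<not> return_time j x \<le> enat r} \<subseteq> {x\<in>space M. 1 \<le> ennreal (1 / r) * ?u x}"
    proof safe
      fix x assume "x \<in> space M" "\<not> return_time j x \<le> enat r"
      then have "of_nat r \<le> ?u x" by (cases "return_time j x") (auto)
      then have "ennreal (1 / r) * of_nat r \<le> ennreal (1 / r) * ?u x" by (rule mult_left_mono) simp
      then show "1 \<le> ennreal (1 / r) * ?u x"
        using assms by (simp add: ennreal_of_nat_eq_real_of_nat ennreal_mult[symmetric])
    qed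
  qed measurable
  also have "\<dots> \<le> ennreal (1 / r) * (\<integral>\<^sup>+x. ?u x \<partial>M)"
    using nn_integral_Markov_inequality[of ?u "space M" M "ennreal (1 / r)"]
    by (simp add: indicator_def cong: nn_integral_cong)
  also have "\<dots> \<le> ennreal (1 / r) * of_nat (j * card (range c))"
    by (intro mult_left_mono nn_integral_return_time_le) simp
  also have "\<dots> = ennreal (real (j * card (range c)) / real r)"
    by (simp only: ennreal_of_nat_eq_real_of_nat) (simp add: ennreal_mult[symmetric])
  finally show ?thesis
    by (simp add: emeasure_eq_measure)
qed

end

section \<open>Averages along the jumps\<close>

text \<open>The integrable functions in the \<open>L\<^sup>1\<close>-closure of \<open>V\<close> are closed under linear combinations and
under dominated pointwise limits. So the indicators among them form a Dynkin class, which contains the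
\<open>\<sigma>\<close>-algebra generated by \<open>G\<close>, and integrable functions are dominated limits of simple functions.\<close>

lemma (in finite_measure) L1_dense_of_generator:
  fixes u :: "'a \<Rightarrow> real" and V :: "('a \<Rightarrow> real) \<Rightarrow> bool"
  assumes F: "subalgebra M F" and G: "Int_stable G" "sets F = sigma_sets (space M) G"
    and V_integrable: "\<And>f. V f \<Longrightarrow> integrable M f"
    and V_add: "\<And>f g. V f \<Longrightarrow> V g \<Longrightarrow> V (\<lambda>x. f x + g x)"
    and V_scale: "\<And>f a. V f \<Longrightarrow> V (\<lambda>x. a * f x)"
    and V_one: "V (\<lambda>x. 1)"
    and V_indicator: "\<And>A. A \<in> G \<Longrightarrow> V (indicator A)"
    and u: "u \<in> borel_measurable F" "integrable M u" and e: "e > 0"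
  obtains h where "V h" "(\<integral>x. \<bar>u x - h x\<bar> \<partial>M) < e"
proof -
  define D where "D u \<longleftrightarrow> (\<forall>e>0. \<exists>h. V h \<and> (\<integral>x. \<bar>u x - h x\<bar> \<partial>M) < e)" for u
  have D_V: "D f" if "V f" for f
    unfolding D_def using that by (auto intro!: exI[of _ f])
  have D_add: "D (\<lambda>x. f x + g x)" if "D f" "D g" "integrable M f" "integrable M g" for f g
    unfolding D_def
  proof (intro allI impI)
    fix e :: real assume "e > 0"
    then have "e / 2 > 0" by simp
    with that obtain h k where h: "V h" "(\<integral>x. \<bar>f x - h x\<bar> \<partial>M) < e / 2"
      and k: "V k" "(\<integral>x. \<bar>g x - k x\<bar> \<partial>M) < e / 2"
      unfolding D_def by meson
    note [simp] = that(3,4) h(1)[THEN V_integrable] k(1)[THEN V_integrable]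
    have "(\<integral>x. \<bar>f x + g x - (h x + k x)\<bar> \<partial>M) \<le> (\<integral>x. \<bar>f x - h x\<bar> + \<bar>g x - k x\<bar> \<partial>M)"
      by (intro integral_mono) auto
    also have "\<dots> = (\<integral>x. \<bar>f x - h x\<bar> \<partial>M) + (\<integral>x. \<bar>g x - k x\<bar> \<partial>M)"
      by (intro Bochner_Integration.integral_add) auto
    finally show "\<exists>h. V h \<and> (\<integral>x. \<bar>f x + g x - h x\<bar> \<partial>M) < e"
      using h k V_add by (intro exI[of _ "\<lambda>x. h x + k x"]) auto
  qed
  (* The factor |a| + 1 instead of |a| covers a = 0. *)
  have D_scale: "D (\<lambda>x. a * f x)" if "D f" "integrable M f" for a f
    unfolding D_def
  proof (intro allI impI)
    fix e :: real assume "e > 0"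
    then have "e / (\<bar>a\<bar> + 1) > 0" by simp
    with that obtain h where h: "V h" "(\<integral>x. \<bar>f x - h x\<bar> \<partial>M) < e / (\<bar>a\<bar> + 1)"
      unfolding D_def by meson
    have "(\<integral>x. \<bar>a * f x - a * h x\<bar> \<partial>M) = \<bar>a\<bar> * (\<integral>x. \<bar>f x - h x\<bar> \<partial>M)"
      by (simp add: right_diff_distrib[symmetric] abs_mult)
    also have "\<dots> \<le> (\<bar>a\<bar> + 1) * (\<integral>x. \<bar>f x - h x\<bar> \<partial>M)"
      by (intro mult_right_mono) auto
    also have "\<dots> < e" using h(2) by (simp add: field_simps)
    finally show "\<exists>h. V h \<and> (\<integral>x. \<bar>a * f x - h x\<bar> \<partial>M) < e"
      using V_scale[OF h(1), of a] by blast
  qed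
  have D_lim: "D f" if D_s: "\<And>i. D (s i)" and "\<And>i. integrable M (s i)" "integrable M f"
    and lim: "(\<lambda>i. \<integral>x. \<bar>f x - s i x\<bar> \<partial>M) \<longlonglongrightarrow> 0" for f and s :: "nat \<Rightarrow> _"
    unfolding D_def
  proof (intro allI impI)
    fix e :: real assume "e > 0"
    then have e2: "e / 2 > 0" by simp
    obtain i where i: "(\<integral>x. \<bar>f x - s i x\<bar> \<partial>M) < e / 2"
      using order_tendstoD(2)[OF lim e2] by (auto simp: eventually_sequentially)
    obtain h where h: "V h" "(\<integral>x. \<bar>s i x - h x\<bar> \<partial>M) < e / 2"
      using D_s[of i] e2 unfolding D_def by meson
    note [simp] = that(2,3) h(1)[THEN V_integrable]
    have "(\<integral>x. \<bar>f x - h x\<bar> \<partial>M) \<le> (\<integral>x. \<bar>f x - s i x\<bar> + \<bar>s i x - h x\<bar> \<partial>M)"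
      by (intro integral_mono) auto
    also have "\<dots> = (\<integral>x. \<bar>f x - s i x\<bar> \<partial>M) + (\<integral>x. \<bar>s i x - h x\<bar> \<partial>M)"
      by (intro Bochner_Integration.integral_add) auto
    finally show "\<exists>h. V h \<and> (\<integral>x. \<bar>f x - h x\<bar> \<partial>M) < e"
      using h i by (intro exI[of _ h]) auto
  qed
  have L1_lim: "(\<lambda>i. \<integral>x. \<bar>f x - s i x\<bar> \<partial>M) \<longlonglongrightarrow> 0"
    if [measurable]: "f \<in> borel_measurable M" "\<And>i. s i \<in> borel_measurable M" 
      and w: "integrable M w" "\<And>i x. x \<in> space M \<Longrightarrow> \<bar>s i x\<bar> \<le> w x" "\<And>x. x \<in> space M \<Longrightarrow> \<bar>f x\<bar> \<le> w x"
      and "\<And>x. x \<in> space M \<Longrightarrow> (\<lambda>i. s i x) \<longlonglongrightarrow> f x" for f w and s :: "nat \<Rightarrow> 'a \<Rightarrow> real"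
  proof -
    have "(\<lambda>i. \<integral>x. \<bar>f x - s i x\<bar> \<partial>M) \<longlonglongrightarrow> (\<integral>x. 0 \<partial>M)"
    proof (rule integral_dominated_convergence[where w="\<lambda>x. 2 * w x"])
      show "AE x in M. (\<lambda>i. \<bar>f x - s i x\<bar>) \<longlonglongrightarrow> 0"
      proof (rule AE_I2)
        fix x assume "x \<in> space M"
        then have "(\<lambda>i. \<bar>f x - s i x\<bar>) \<longlonglongrightarrow> \<bar>f x - f x\<bar>"
          by (intro tendsto_intros that)
        then show "(\<lambda>i. \<bar>f x - s i x\<bar>) \<longlonglongrightarrow> 0" by simp
      qed
      show "AE x in M. norm \<bar>f x - s i x\<bar> \<le> 2 * w x" for i
      proof (rule AE_I2)
        fix x assume "x \<in> space M"
        then show "norm \<bar>f x - s i x\<bar> \<le> 2 * w x" using w(2)[of x i] w(3)[of x] by simp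
      qed
    qed (use w(1) in auto)
    then show ?thesis by simp
  qed
  have F_M: "A \<in> sets M" if "A \<in> sets F" for A
    using F that unfolding subalgebra_def by blast
  have ind_int [simp]: "integrable M (indicator A :: _ \<Rightarrow> real)" if "A \<in> sets F" for A
    using F_M[OF that] by (simp add: less_top[symmetric])
  have G_Pow: "G \<subseteq> Pow (space M)"
    using G(2) F sets.space_closed[of F] unfolding subalgebra_def by (metis sigma_sets.Basic subsetI subset_trans)
  have D_indicator: "D (indicator A)" if "A \<in> sets F" for A
  proof -
    have "A \<in> sigma_sets (space M) G" using that G(2) by simp
    with G(1) G_Pow show ?thesis
    proof (induction rule: sigma_sets_induct_disjoint)
      case (basic A)
      then show ?case by (intro D_V V_indicator)
    next
      case empty
      then show ?case using D_V[OF V_scale[OF V_one, of 0]] by (simp add: indicator_def)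
    next
      case (compl A)
      then have A: "A \<in> sets F" using G(2) by simp
      have "D (\<lambda>x. 1 + (- 1) * indicator A x)"
        using compl A by (intro D_add D_V[OF V_one] D_scale) auto
      moreover have "(\<integral>x. \<bar>indicator (space M - A) x - h x\<bar> \<partial>M) = (\<integral>x. \<bar>1 + (- 1) * indicator A x - h x\<bar> \<partial>M)" for h :: "'a \<Rightarrow> real"
        by (intro Bochner_Integration.integral_cong) (auto simp: indicator_def)
      ultimately show ?case unfolding D_def by simp
    next
      case (union A)
      have A: "A i \<in> sets F" for i using union G(2) by auto
      define s where "s n = (\<lambda>x. \<Sum>i<n. indicator (A i) x :: real)" for n :: nat
      have s_int: "integrable M (s n)" for n unfolding s_def using A by auto
      have s_eq: "s n x = indicator (\<Union>i<n. A i) x" for n x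
      proof -
        have "disjoint_family_on A {..<n}"
          using union(1) by (auto simp: disjoint_family_on_def)
        then show ?thesis unfolding s_def
          by (subst indicator_UN_disjoint) auto
      qed
      have "D (s n)" for n
      proof (induction n)
        case 0
        show ?case using D_V[OF V_scale[OF V_one, of 0]] by (simp add: s_def)
      next
        case (Suc n)
        have "D (\<lambda>x. s n x + indicator (A n) x)"
          using Suc union.IH[of n] s_int A by (intro D_add) auto
        then show ?case by (simp add: s_def)
      qed
      then show ?case
      proof (rule D_lim)
        have [measurable]: "A i \<in> sets M" for i using A F_M by blast
        show "(\<lambda>i. \<integral>x. \<bar>indicator (\<Union>i. A i) x - s i x\<bar> \<partial>M) \<longlonglongrightarrow> 0"
        proof (rule L1_lim[where w="\<lambda>x. 1"])
          show "(\<lambda>n. s n x) \<longlonglongrightarrow> indicator (\<Union>i. A i) x" for x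
            unfolding s_eq by (rule LIMSEQ_indicator_UN)
          show "\<bar>s n x\<bar> \<le> 1" for n x
            by (simp add: s_eq indicator_def)
          show "s n \<in> borel_measurable M" for n
            unfolding s_def by measurable
        qed (auto simp: indicator_def)
      qed (use s_int A in auto)
    qed
  qed
  let ?R = "restr_to_subalg M F"
  have "integrable ?R u" by (rule integrable_in_subalg[OF F u])
  then have "D u"
  proof (induction rule: integrable_induct)
    case (base A c)
    then have "A \<in> sets F" by (simp add: sets_restr_to_subalg[OF F])
    then have "D (\<lambda>x. c * indicator A x)" by (intro D_scale D_indicator) auto
    then show ?case by (simp add: mult.commute)
  next
    case (add f g)
    then show ?case by (intro D_add) (auto intro: integrable_from_subalg[OF F])
  next
    case (lim f s)
    have int: "integrable M f" "integrable M (s i)" for i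
      using lim by (auto intro: integrable_from_subalg[OF F])
    show ?case
    proof (rule D_lim[where s=s])
      show "(\<lambda>i. \<integral>x. \<bar>f x - s i x\<bar> \<partial>M) \<longlonglongrightarrow> 0"
        using int lim by (intro L1_lim[where w="\<lambda>x. 2 * \<bar>f x\<bar>"]) (auto simp: space_restr_to_subalg)
    qed (use lim int in auto)
  qed
  then show thesis using e that unfolding D_def by blast
qed

text \<open>The variance of \<open>\<bar>Y\<bar>\<close> is nonnegative.\<close>

lemma (in prob_space) square_expectation_abs_le:
  fixes Y :: "'a \<Rightarrow> real"
  assumes "integrable M Y" "integrable M (\<lambda>x. (Y x)\<^sup>2)"
  shows "(\<integral>x. \<bar>Y x\<bar> \<partial>M)\<^sup>2 \<le> (\<integral>x. (Y x)\<^sup>2 \<partial>M)"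
proof -
  have "variance (\<lambda>x. \<bar>Y x\<bar>) = (\<integral>x. (Y x)\<^sup>2 \<partial>M) - (\<integral>x. \<bar>Y x\<bar> \<partial>M)\<^sup>2"
    using assms by (subst variance_eq) auto
  then show ?thesis using variance_positive[of "\<lambda>x. \<bar>Y x\<bar>"] by simp
qed

lemma (in prob_space) abs_expectation_le:
  fixes f :: "'a \<Rightarrow> real"
  assumes [measurable]: "f \<in> borel_measurable M" and bound: "\<And>x. \<bar>f x\<bar> \<le> C"
  shows "\<bar>expectation f\<bar> \<le> C"
proof -
  have C: "0 \<le> C" using bound[of undefined] by simp
  have "\<bar>expectation f\<bar> \<le> (\<integral>x. \<bar>f x\<bar> \<partial>M)" by (rule integral_abs_bound)
  also have "\<dots> \<le> (\<integral>x. C \<partial>M)"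
    using bound C by (intro integral_mono integrable_const_bound[where B=C]) auto
  finally show ?thesis by (simp add: prob_space)
qed

context labelled_flow
begin

lemma integrable_bounded_jump:
  fixes f :: "'a \<Rightarrow> real"
  assumes "f \<in> borel_measurable M" "\<And>x. \<bar>f x\<bar> \<le> C"
  shows "integrable M (\<lambda>x. f (jump j x))"
  using assms by (intro integrable_jump integrable_const_bound[where B=C]) auto

text \<open>By \<open>jump_add\<close> and invariance, the correlation of the terms \<open>i < j\<close> equals that of \<open>d\<close> with
\<open>d \<circ> jump (j - i)\<close>, which vanishes. Only the \<open>n\<close> diagonal terms remain.\<close>

lemma integral_square_sum_jump_le:
  fixes d :: "'a \<Rightarrow> real"
  assumes [measurable]: "d \<in> borel_measurable M" and bound: "\<And>x. \<bar>d x\<bar> \<le> C"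
    and orth: "\<And>m. m \<ge> 1 \<Longrightarrow> (\<integral>x. d x * d (jump m x) \<partial>M) = 0"
  shows "(\<integral>x. (\<Sum>j=1..n. d (jump j x))\<^sup>2 \<partial>M) \<le> real n * C\<^sup>2"
proof -
  have C: "0 \<le> C" using bound[of undefined] by simp
  have prod_bound: "\<bar>d x * d y\<bar> \<le> C * C" for x y
    using bound[of x] bound[of y] C by (simp add: abs_mult mult_mono)
  have int [simp]: "integrable M (\<lambda>x. d (jump i x) * d (jump j x))" for i j
    using prod_bound by (intro integrable_const_bound[where B="C * C"]) auto
  have off: "(\<integral>x. d (jump i x) * d (jump j x) \<partial>M) = 0" if "i < j" for i j
  proof -
    have "(\<integral>x. d (jump i x) * d (jump j x) \<partial>M) = (\<integral>x. d (jump i x) * d (jump (j - i) (jump i x)) \<partial>M)"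
    proof (rule integral_cong_AE)
      show "AE x in M. d (jump i x) * d (jump j x) = d (jump i x) * d (jump (j - i) (jump i x))"
        using AE_return_time_finite[of i] AE_return_time_finite[of j]
      proof eventually_elim
        case (elim x)
        then have "return_time (j - i) (jump i x) \<noteq> \<infinity>"
          using return_time_add[of i x "j - i"] that
          by (metis add_diff_inverse_nat not_less_iff_gr_or_eq plus_eq_infty_iff_enat)
        then show ?case using jump_add[of i x "j - i"] elim that by simp
      qed
    qed measurable
    also have "\<dots> = (\<integral>x. d x * d (jump (j - i) x) \<partial>M)"
      by (rule integral_jump) measurable
    finally show ?thesis using orth[of "j - i"] that by simp
  qed
  have "(\<integral>x. (\<Sum>j=1..n. d (jump j x))\<^sup>2 \<partial>M) = (\<Sum>i=1..n. \<Sum>j=1..n. \<integral>x. d (jump i x) * d (jump j x) \<partial>M)"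
    by (simp add: power2_eq_square sum_product)
  also have "\<dots> = (\<Sum>i=1..n. \<integral>x. d (jump i x) * d (jump i x) \<partial>M)"
  proof (rule sum.cong[OF refl])
    fix i assume i: "i \<in> {1..n}"
    have "(\<integral>x. d (jump i x) * d (jump j x) \<partial>M) = 0" if "j \<noteq> i" for j
      using off[of i j] off[of j i] that by (cases i j rule: linorder_cases) (auto simp: mult.commute)
    then show "(\<Sum>j=1..n. \<integral>x. d (jump i x) * d (jump j x) \<partial>M) = (\<integral>x. d (jump i x) * d (jump i x) \<partial>M)"
      using i by (subst sum.remove[of _ i]) auto
  qed
  also have "\<dots> \<le> (\<Sum>i=1..n. C * C)"
  proof (rule sum_mono)
    fix i
    have "(\<integral>x. d (jump i x) * d (jump i x) \<partial>M) \<le> (\<integral>x. C * C \<partial>M)"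
      using prod_bound by (intro integral_mono) (auto intro: order_trans[OF abs_ge_self])
    then show "(\<integral>x. d (jump i x) * d (jump i x) \<partial>M) \<le> C * C" by (simp add: prob_space)
  qed
  finally show ?thesis by (simp add: power2_eq_square)
qed

lemma integral_abs_average_jump_le:
  fixes d :: "'a \<Rightarrow> real"
  assumes [measurable]: "d \<in> borel_measurable M" and bound: "\<And>x. \<bar>d x\<bar> \<le> C"
    and orth: "\<And>m. m \<ge> 1 \<Longrightarrow> (\<integral>x. d x * d (jump m x) \<partial>M) = 0"
  shows "(\<integral>x. \<bar>(\<Sum>j=1..n. d (jump j x)) / real n\<bar> \<partial>M) \<le> C / sqrt (real n)"
proof (cases "n = 0")
  case False
  let ?Y = "\<lambda>x. \<Sum>j=1..n. d (jump j x)"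
  have C: "0 \<le> C" using bound[of undefined] by simp
  have Y_bound: "\<bar>?Y x\<bar> \<le> real n * C" for x
  proof -
    have "\<bar>?Y x\<bar> \<le> (\<Sum>j=1..n. \<bar>d (jump j x)\<bar>)" by (rule sum_abs)
    also have "\<dots> \<le> (\<Sum>j=1..n. C)" by (intro sum_mono bound)
    finally show ?thesis by simp
  qed
  have "(\<integral>x. \<bar>?Y x\<bar> \<partial>M)\<^sup>2 \<le> (\<integral>x. (?Y x)\<^sup>2 \<partial>M)"
  proof (rule square_expectation_abs_le)
    show "integrable M ?Y"
      by (intro Bochner_Integration.integrable_sum integrable_bounded_jump[OF assms(1) bound])
    have "\<bar>(?Y x)\<^sup>2\<bar> \<le> (real n * C)\<^sup>2" for x
      using Y_bound[of x] by (simp add: power2_le_iff_abs_le C)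
    then show "integrable M (\<lambda>x. (?Y x)\<^sup>2)"
      by (intro integrable_const_bound[where B="(real n * C)\<^sup>2"]) auto
  qed
  also have "\<dots> \<le> real n * C\<^sup>2"
    using assms by (rule integral_square_sum_jump_le)
  also have "\<dots> = (sqrt (real n) * C)\<^sup>2" by (simp add: power_mult_distrib)
  finally have "(\<integral>x. \<bar>?Y x\<bar> \<partial>M) \<le> sqrt (real n) * C"
    by (rule power2_le_imp_le) (use C in auto)
  then have "(\<integral>x. \<bar>?Y x\<bar> \<partial>M) / real n \<le> sqrt (real n) * C / real n"
    by (rule divide_right_mono) simp
  also have "\<dots> = C / sqrt (real n)" using False by (simp add: field_simps)
  finally show ?thesis by simp
qed simp

text \<open>Split \<open>\<phi> = (\<phi> - g) + (g - h) + h\<close> along the jumps. The first part is an average of orthogonal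
terms; the average of the last part is exactly \<open>h x\<close>, since jumping does not change the label; and
\<open>g - h\<close> enters once through its average along the jumps and once at \<open>x\<close> itself.\<close>

lemma integral_abs_average_error_le:
  fixes \<phi> g h :: "'a \<Rightarrow> real"
  assumes [measurable]: "\<phi> \<in> borel_measurable M" "g \<in> borel_measurable M"
    and bound: "\<And>x. \<bar>\<phi> x\<bar> \<le> C" "\<And>x. \<bar>g x\<bar> \<le> C"
    and orth: "\<And>m. m \<ge> 1 \<Longrightarrow> (\<integral>x. (\<phi> x - g x) * (\<phi> (jump m x) - g (jump m x)) \<partial>M) = 0"
    and h: "integrable M h" "\<And>x y. c x = c y \<Longrightarrow> h x = h y"
    and n: "n \<ge> 1"
  shows "(\<integral>x. \<bar>(\<Sum>j=1..n. \<phi> (jump j x)) / real n - g x\<bar> \<partial>M)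
    \<le> 2 * C / sqrt (real n) + 2 * (\<integral>x. \<bar>g x - h x\<bar> \<partial>M)"
proof -
  define d where "d x = \<phi> x - g x" for x
  have d_meas [measurable]: "d \<in> borel_measurable M" unfolding d_def by measurable
  have d_bound: "\<bar>d x\<bar> \<le> 2 * C" for x
    unfolding d_def using bound[of x] by linarith
  have g_int: "integrable M g" using bound by (intro integrable_const_bound[where B=C]) auto
  have [simp]: "integrable M (\<lambda>x. \<phi> (jump j x))" "integrable M (\<lambda>x. d (jump j x))"
    "integrable M (\<lambda>x. \<bar>g (jump j x) - h (jump j x)\<bar>)" "integrable M (\<lambda>x. \<bar>g x - h x\<bar>)" for j
    using integrable_bounded_jump[OF assms(1) bound(1), of j] integrable_bounded_jump[OF d_meas d_bound, of j]
      g_int h(1) integrable_jump[of "\<lambda>x. \<bar>g x - h x\<bar>" j]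
    by (simp_all del: integrable_abs_iff)
  have "AE x in M. \<forall>j\<in>{1..n}. return_time j x \<noteq> \<infinity>"
    using AE_return_time_finite by (intro AE_finite_allI) auto
  then have "AE x in M. \<bar>(\<Sum>j=1..n. \<phi> (jump j x)) / real n - g x\<bar>
     \<le> \<bar>(\<Sum>j=1..n. d (jump j x)) / real n\<bar> + (\<Sum>j=1..n. \<bar>g (jump j x) - h (jump j x)\<bar>) / real n + \<bar>g x - h x\<bar>"
  proof eventually_elim
    case (elim x)
    have hx: "h (jump j x) = h x" if "j \<in> {1..n}" for j
      using elim that by (intro h(2) label_jump) blast
    have "(\<Sum>j=1..n. \<phi> (jump j x)) / real n =
        (\<Sum>j=1..n. d (jump j x) + (g (jump j x) - h (jump j x)) + h (jump j x)) / real n"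
      unfolding d_def by simp
    also have "\<dots> = (\<Sum>j=1..n. d (jump j x)) / real n + (\<Sum>j=1..n. g (jump j x) - h (jump j x)) / real n
        + (\<Sum>j=1..n. h (jump j x)) / real n"
      by (simp only: sum.distrib add_divide_distrib)
    also have "(\<Sum>j=1..n. h (jump j x)) / real n = h x"
      using hx n by simp
    finally have eq: "(\<Sum>j=1..n. \<phi> (jump j x)) / real n =
        (\<Sum>j=1..n. d (jump j x)) / real n + (\<Sum>j=1..n. g (jump j x) - h (jump j x)) / real n + h x" .
    have "\<bar>(\<Sum>j=1..n. g (jump j x) - h (jump j x)) / real n\<bar> \<le> (\<Sum>j=1..n. \<bar>g (jump j x) - h (jump j x)\<bar>) / real n"
      by (simp add: divide_right_mono)
    then show ?case unfolding eq by linarith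
  qed
  then have "(\<integral>x. \<bar>(\<Sum>j=1..n. \<phi> (jump j x)) / real n - g x\<bar> \<partial>M)
     \<le> (\<integral>x. \<bar>(\<Sum>j=1..n. d (jump j x)) / real n\<bar> + (\<Sum>j=1..n. \<bar>g (jump j x) - h (jump j x)\<bar>) / real n + \<bar>g x - h x\<bar> \<partial>M)"
    using g_int by (intro integral_mono_AE) auto
  also have "\<dots> = (\<integral>x. \<bar>(\<Sum>j=1..n. d (jump j x)) / real n\<bar> \<partial>M)
      + (\<Sum>j=1..n. \<integral>x. \<bar>g (jump j x) - h (jump j x)\<bar> \<partial>M) / real n + (\<integral>x. \<bar>g x - h x\<bar> \<partial>M)"
    by simp
  also have "(\<Sum>j=1..n. \<integral>x. \<bar>g (jump j x) - h (jump j x)\<bar> \<partial>M) = (\<Sum>j=1..n. \<integral>x. \<bar>g x - h x\<bar> \<partial>M)"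
  proof (rule sum.cong[OF refl])
    show "(\<integral>x. \<bar>g (jump j x) - h (jump j x)\<bar> \<partial>M) = (\<integral>x. \<bar>g x - h x\<bar> \<partial>M)" for j
      using h(1) by (intro integral_jump[where f="\<lambda>x. \<bar>g x - h x\<bar>"]) auto
  qed
  also have "(\<integral>x. \<bar>(\<Sum>j=1..n. d (jump j x)) / real n\<bar> \<partial>M) \<le> 2 * C / sqrt (real n)"
    using orth by (intro integral_abs_average_jump_le d_bound d_meas) (simp add: d_def)
  finally show ?thesis using n by simp
qed

end

section \<open>Path space and quantised blocks\<close>

text \<open>In a finite field the intersection of all sets containing a point is the atom of that point, so
the definite description in \<^const>\<open>atom_of\<close> is always meaningful.\<close>

lemma atom_of_eq_Inter:
  assumes "sigma_algebra UNIV F" "finite F"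
  shows "atom_of F x = \<Inter>{A\<in>F. x \<in> A}" and "atom_of F x \<in> atoms F" 
proof -
  interpret sigma_algebra UNIV F by fact
  let ?I = "\<Inter>{A\<in>F. x \<in> A}"
  have x_I: "x \<in> ?I" by blast
  have "(\<Inter>A\<in>{A\<in>F. x \<in> A}. A) \<in> F"
  proof (rule finite_INT)
    show "finite {A\<in>F. x \<in> A}" using assms(2) by simp
    show "{A\<in>F. x \<in> A} \<noteq> {}" using top by blast
  qed blast
  then have I: "?I \<in> F" by simp
  have *: "?I \<in> atoms F"
    unfolding atoms_def
  proof (intro CollectI conjI ballI impI)
    show "?I \<in> F" by (rule I)
    show "?I \<noteq> {}" using x_I by blast
    fix C assume C: "C \<in> F" "C \<subseteq> ?I"
    show "C = {} \<or> C = ?I"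
    proof (cases "x \<in> C")
      case True
      then have "?I \<subseteq> C" using C by blast
      then show ?thesis using C by blast
    next
      case False
      then have "UNIV - C \<in> {A\<in>F. x \<in> A}" using compl_sets[OF C(1)] by simp
      then have "?I \<subseteq> UNIV - C" by (rule Inter_lower)
      then show ?thesis using C by blast
    qed
  qed
  have "A = ?I" if "A \<in> atoms F" "x \<in> A" for A
  proof -
    have "A \<in> {A\<in>F. x \<in> A}" using that unfolding atoms_def by blast
    then have "?I \<subseteq> A" by (rule Inter_lower)
    then show ?thesis using that(1) I x_I unfolding atoms_def by blast
  qed
  then show "atom_of F x = ?I"
    unfolding atom_of_def using * x_I by (intro the_equality) blast+
  with * show "atom_of F x \<in> atoms F" by simp
qed

lemma atom_of_eq_imp_mem_iff:
  assumes "sigma_algebra UNIV F" "finite F" "B \<in> F" "atom_of F x = atom_of F y"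
  shows "x \<in> B \<longleftrightarrow> y \<in> B"
proof -
  have "x \<in> atom_of F x" "y \<in> atom_of F y"
    by (simp_all add: atom_of_eq_Inter[OF assms(1,2)])
  moreover have "atom_of F z \<subseteq> B" if "z \<in> B" for z
    using that assms(3) by (auto simp: atom_of_eq_Inter[OF assms(1,2)])
  ultimately show ?thesis using assms(4) by auto
qed

lemma measurable_atom_of:
  assumes F: "sigma_algebra UNIV F" "finite F" and borel: "F \<subseteq> sets borel"
  shows "atom_of F \<in> borel \<rightarrow>\<^sub>M count_space UNIV"
proof -
  have "finite (atoms F)" using F(2) by (auto simp: atoms_def)
  have "atom_of F \<in> borel \<rightarrow>\<^sub>M count_space (atoms F)"
    unfolding measurable_count_space_eq2[OF \<open>finite (atoms F)\<close>]
  proof (intro conjI ballI)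
    show "atom_of F \<in> space borel \<rightarrow> atoms F" using atom_of_eq_Inter(2)[OF F] by auto
    fix A assume A: "A \<in> atoms F"
    have "atom_of F x = A \<longleftrightarrow> x \<in> A" for x
    proof
      assume "atom_of F x = A"
      then show "x \<in> A" by (auto simp: atom_of_eq_Inter(1)[OF F])
    next
      assume "x \<in> A"
      have "A \<in> F" using A by (auto simp: atoms_def)
      then have "atom_of F x \<subseteq> A" using \<open>x \<in> A\<close> by (auto simp: atom_of_eq_Inter(1)[OF F])
      moreover have "atom_of F x \<in> F" "atom_of F x \<noteq> {}"
        using atom_of_eq_Inter(2)[OF F, of x] by (auto simp: atoms_def)
      ultimately show "atom_of F x = A" using A by (auto simp: atoms_def)
    qed
    then have "atom_of F -` {A} \<inter> space borel = A" by auto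
    then show "atom_of F -` {A} \<inter> space borel \<in> sets borel"
      using A borel by (auto simp: atoms_def)
  qed
  from measurable_compose[OF this, of "\<lambda>b. b" "count_space UNIV"] show ?thesis by simp
qed

definition time_shift :: "int \<Rightarrow> (int \<Rightarrow> real) \<Rightarrow> int \<Rightarrow> real" where
  "time_shift t x = (\<lambda>s. x (s + t))"

text \<open>As an extensional function, the label lies in a finite product of copies of the set of atoms, which
both counts the labels and makes equality of labels equivalent to recurrence of the block.\<close>

definition block_label :: "real set set \<Rightarrow> nat \<Rightarrow> (int \<Rightarrow> real) \<Rightarrow> nat \<Rightarrow> real set" where
  "block_label F l x = (\<lambda>i\<in>{1..l}. atom_of F (x (- int i)))"

abbreviation past_field :: "(int \<Rightarrow> real) measure" where
  "past_field \<equiv> past_algebra path_space (\<lambda>t x. x t)"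

lemma block_recurs_iff: "block_recurs F l x t \<longleftrightarrow> block_label F l (time_shift (- int t) x) = block_label F l x"
  unfolding block_recurs_def block_label_def time_shift_def fun_eq_iff restrict_def by auto

lemma block_label_mem: 
  assumes "sigma_algebra UNIV F" "finite F"
  shows "block_label F l x \<in> {1..l} \<rightarrow>\<^sub>E atoms F"
  unfolding block_label_def using atom_of_eq_Inter(2)[OF assms] by auto

lemma
  assumes "sigma_algebra UNIV F" "finite F"
  shows finite_range_block_label: "finite (range (block_label F l))"
    and card_range_block_label_le: "card (range (block_label F l)) \<le> card (atoms F) ^ l"
proof -
  have sub: "range (block_label F l) \<subseteq> ({1..l} \<rightarrow>\<^sub>E atoms F)" using block_label_mem[OF assms] by auto
  have fin: "finite ({1..l} \<rightarrow>\<^sub>E atoms F)"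
    using assms(2) by (intro finite_PiE) (auto simp: atoms_def)
  show "finite (range (block_label F l))" using sub fin by (rule finite_subset)
  show "card (range (block_label F l)) \<le> card (atoms F) ^ l"
    using card_mono[OF fin sub] by (simp add: card_PiE)
qed

lemma measurable_block_label:
  assumes F: "sigma_algebra UNIV F" "finite F" "F \<subseteq> sets borel"
    and N: "\<And>t. t < 0 \<Longrightarrow> (\<lambda>x. x t) \<in> borel_measurable N"
  shows "block_label F l \<in> N \<rightarrow>\<^sub>M count_space UNIV"
proof -
  let ?P = "{1..l} \<rightarrow>\<^sub>E atoms F"
  have fin: "finite ?P"
    using F(2) by (intro finite_PiE) (auto simp: atoms_def)
  have "block_label F l \<in> N \<rightarrow>\<^sub>M count_space ?P"
    unfolding measurable_count_space_eq2[OF fin]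
  proof (intro conjI ballI)
    show "block_label F l \<in> space N \<rightarrow> ?P" using block_label_mem[OF F(1,2)] by auto
    fix b assume b: "b \<in> ?P"
    have [measurable]: "(\<lambda>x. atom_of F (x (- int i))) \<in> N \<rightarrow>\<^sub>M count_space UNIV" if "i \<in> {1..l}" for i
      using that by (intro measurable_compose[OF N measurable_atom_of[OF F]]) auto
    have "block_label F l x = b \<longleftrightarrow> (\<forall>i\<in>{1..l}. atom_of F (x (- int i)) = b i)" for x
      using b by (auto simp: block_label_def fun_eq_iff PiE_def extensional_def restrict_def)
    then have "block_label F l -` {b} \<inter> space N = {x\<in>space N. \<forall>i\<in>{1..l}. atom_of F (x (- int i)) = b i}"
      by auto
    also have "\<dots> \<in> sets N" by measurable
    finally show "block_label F l -` {b} \<inter> space N \<in> sets N" .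
  qed
  from measurable_compose[OF this, of "\<lambda>b. b" "count_space UNIV"] show ?thesis by simp
qed

lemma space_path_space [simp]: "space path_space = UNIV"
  by (simp add: space_PiM PiE_def)

lemma space_past_field [simp]: "space past_field = UNIV"
  by (simp add: past_algebra_def)

lemma measurable_past_process:
  assumes "t < 0"
  shows "(\<lambda>\<omega>. X t \<omega>) \<in> borel_measurable (past_algebra M X)"
proof -
  have "(\<lambda>\<omega>. \<lambda>t\<in>{..<0}. X t \<omega>) \<in> past_algebra M X \<rightarrow>\<^sub>M Pi\<^sub>M {..<0} (\<lambda>_. borel :: real measure)"
    unfolding past_algebra_def by (rule measurable_vimage_algebra1) (auto simp: space_PiM)
  from measurable_compose[OF this measurable_component_singleton[of t]] assms
  show ?thesis by simp
qed

lemma measurable_past_coordinate: "t < 0 \<Longrightarrow> (\<lambda>x. x t) \<in> borel_measurable past_field"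
  using measurable_past_process[where X="\<lambda>t x. x t"] .

lemma measurable_into_past_fieldI:
  assumes "\<And>t. t < 0 \<Longrightarrow> (\<lambda>x. f x t) \<in> borel_measurable N"
  shows "f \<in> N \<rightarrow>\<^sub>M past_field"
  unfolding past_algebra_def
  by (rule measurable_vimage_algebra2) (auto intro!: measurable_restrict assms)

lemma measurable_shift_path_space: "time_shift t \<in> path_space \<rightarrow>\<^sub>M path_space"
  unfolding time_shift_def
  by (rule measurable_PiM_single') (auto intro: measurable_component_singleton)

lemma measurable_shift_past_field: "time_shift (- int t) \<in> past_field \<rightarrow>\<^sub>M past_field"
  unfolding time_shift_def by (rule measurable_into_past_fieldI) (rule measurable_past_coordinate, simp)

locale stationary_path_measure = prob_space \<nu> for \<nu> :: "(int \<Rightarrow> real) measure" +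
  assumes sets_eq [measurable_cong]: "sets \<nu> = sets path_space"
    and shift_invariant: "distr \<nu> path_space (\<lambda>x t. x (t + 1)) = \<nu>"
begin

lemma space_eq [simp]: "space \<nu> = UNIV"
  using sets_eq_imp_space_eq[OF sets_eq] by simp

lemma measurable_shift [measurable]: "time_shift t \<in> \<nu> \<rightarrow>\<^sub>M \<nu>"
  using measurable_shift_path_space[of t] by (simp cong: measurable_cong_sets add: sets_eq)

lemma measurable_coordinate [measurable]: "(\<lambda>x. x t) \<in> borel_measurable \<nu>"
  by measurable

lemma distr_shift: "distr \<nu> \<nu> (time_shift t) = \<nu>"
proof -
  have shift_shift: "time_shift s \<circ> time_shift t = time_shift (s + t)" for s t
    by (auto simp: time_shift_def fun_eq_iff algebra_simps)
  have forward: "distr \<nu> \<nu> (time_shift (int n)) = \<nu>" for n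
  proof (induction n)
    case 0
    show ?case by (simp add: time_shift_def distr_id)
  next
    case (Suc n)
    have "distr \<nu> \<nu> (time_shift 1) = \<nu>"
      using shift_invariant by (simp add: time_shift_def cong: distr_cong add: sets_eq)
    then have "distr \<nu> \<nu> (time_shift (int (Suc n))) = distr (distr \<nu> \<nu> (time_shift 1)) \<nu> (time_shift (int n))"
      by (subst distr_distr) (simp_all add: shift_shift add.commute)
    with Suc \<open>distr \<nu> \<nu> (time_shift 1) = \<nu>\<close> show ?case by simp
  qed
  show ?thesis
  proof (cases "t \<ge> 0")
    case True
    then show ?thesis using forward[of "nat t"] by simp
  next
    case False
    have "distr \<nu> \<nu> (time_shift t) = distr (distr \<nu> \<nu> (time_shift (- t))) \<nu> (time_shift t)"
      using forward[of "nat (- t)"] False by simp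
    also have "\<dots> = distr \<nu> \<nu> (time_shift 0)"
      by (subst distr_distr) (simp_all add: shift_shift)
    finally show ?thesis using forward[of 0] by simp
  qed
qed

sublocale stationary_flow \<nu> time_shift
  by unfold_locales (simp_all add: distr_shift, simp_all add: time_shift_def algebra_simps)

lemma subalgebra_past: "subalgebra \<nu> past_field"
  unfolding subalgebra_def
proof
  have "(\<lambda>x. x) \<in> \<nu> \<rightarrow>\<^sub>M past_field"
    by (rule measurable_into_past_fieldI) measurable
  then show "sets past_field \<subseteq> sets \<nu>"
    using measurable_sets[of "\<lambda>x. x" \<nu> past_field] by auto
qed simp

lemma measurable_from_past: "f \<in> past_field \<rightarrow>\<^sub>M N \<Longrightarrow> f \<in> \<nu> \<rightarrow>\<^sub>M N"
  using subalgebra_past by (rule measurable_from_subalg)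

text \<open>Clipping the conditional expectation to \<open>[-C, C]\<close> changes it on a null set only and yields a
version that is bounded everywhere.\<close>

lemma bounded_predictor:
  fixes \<phi> :: "real \<Rightarrow> real"
  assumes [measurable]: "\<phi> \<in> borel_measurable borel" and bound: "\<And>y. \<bar>\<phi> y\<bar> \<le> C"
  obtains g where "g \<in> borel_measurable past_field" "\<And>x. \<bar>g x\<bar> \<le> C"
    "\<And>Z c. Z \<in> borel_measurable past_field \<Longrightarrow> (\<And>x. \<bar>Z x\<bar> \<le> c) \<Longrightarrow>
      (\<integral>x. \<phi> (x 0) * Z x \<partial>\<nu>) = (\<integral>x. g x * Z x \<partial>\<nu>)"
proof
  interpret sigma_finite_subalgebra \<nu> past_field
    by (intro finite_measure_subalgebra_is_sigma_finite finite_measure_subalgebra.intro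
        finite_measure_subalgebra_axioms.intro subalgebra_past) unfold_locales
  have C: "0 \<le> C" using bound[of 0] by simp
  let ?r = "real_cond_exp \<nu> past_field (\<lambda>x. \<phi> (x 0))"
  define g where "g x = max (- C) (min C (?r x))" for x
  show g_past [measurable]: "g \<in> borel_measurable past_field" unfolding g_def by measurable
  show "\<bar>g x\<bar> \<le> C" for x using C unfolding g_def by (auto simp: abs_le_iff)
  have \<phi>_int: "integrable \<nu> (\<lambda>x. \<phi> (x 0))"
    using bound by (intro integrable_const_bound[where B=C]) auto
  have "AE x in \<nu>. ?r x \<le> C" "AE x in \<nu>. ?r x \<ge> - C"
    using bound by (intro real_cond_exp_le_c real_cond_exp_ge_c \<phi>_int AE_I2; simp add: abs_le_iff minus_le_iff)+
  then have ae: "AE x in \<nu>. ?r x = g x"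
    unfolding g_def by eventually_elim simp
  fix Z :: "(int \<Rightarrow> real) \<Rightarrow> real" and c
  assume Z [measurable]: "Z \<in> borel_measurable past_field" and c: "\<And>x. \<bar>Z x\<bar> \<le> c"
  note [measurable] = measurable_from_past[OF Z] measurable_from_past[OF g_past]
  have "\<bar>Z x * \<phi> (x 0)\<bar> \<le> c * C" for x
    using c[of x] bound[of "x 0"] C by (simp add: abs_mult mult_mono)
  then have "integrable \<nu> (\<lambda>x. Z x * \<phi> (x 0))"
    by (intro integrable_const_bound[where B="c * C"]) auto
  then have "(\<integral>x. Z x * ?r x \<partial>\<nu>) = (\<integral>x. Z x * \<phi> (x 0) \<partial>\<nu>)"
    by (intro real_cond_exp_intg) auto
  moreover have "(\<integral>x. Z x * ?r x \<partial>\<nu>) = (\<integral>x. Z x * g x \<partial>\<nu>)"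
    using ae by (intro integral_cong_AE) auto
  ultimately show "(\<integral>x. \<phi> (x 0) * Z x \<partial>\<nu>) = (\<integral>x. g x * Z x \<partial>\<nu>)"
    by (simp add: mult.commute)
qed

end

locale quantized_paths = stationary_path_measure \<nu> for \<nu> +
  fixes F :: "real set set" and l :: nat
  assumes field: "sigma_algebra UNIV F" "finite F" "F \<subseteq> sets borel"
begin

lemma measurable_label_past: "block_label F l \<in> past_field \<rightarrow>\<^sub>M count_space UNIV"
  by (rule measurable_block_label[OF field measurable_past_coordinate])

sublocale labelled_flow \<nu> time_shift "block_label F l"
  by unfold_locales
    (rule measurable_from_past[OF measurable_label_past], rule finite_range_block_label[OF field(1,2)])

lemma return_time_eq: "return_time j x = recurrence_time F l x j"
  unfolding return_time_def recurrence_time_eq_nth_hit block_recurs_iff ..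

lemma jump_0: "jump j x 0 = x (- int (the_enat (recurrence_time F l x j)))"
  by (simp add: jump_def time_shift_def return_time_eq)

lemma measurable_return_time_past: "return_time j \<in> past_field \<rightarrow>\<^sub>M count_space UNIV"
  unfolding return_time_def
  by (intro measurable_nth_hit pred_eq_of_finite_range[OF _ measurable_label_past finite_labels]
      measurable_compose[OF measurable_shift_past_field measurable_label_past]) simp

text \<open>For \<open>m \<ge> 1\<close> the return time is at least 1, so the path jumped to involves only coordinates with
negative index at and before its time 0: the second factor agrees almost surely with a
past-measurable \<open>Z\<close>, against which \<open>\<phi>(x\<^sub>0)\<close> and \<open>g\<close> integrate equally.\<close>

lemma innovation_orthogonal:
  fixes \<phi> :: "real \<Rightarrow> real"
  assumes [measurable]: "\<phi> \<in> borel_measurable borel" and bound: "\<And>y. \<bar>\<phi> y\<bar> \<le> C"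
    and g [measurable]: "g \<in> borel_measurable past_field" and g_bound: "\<And>x. \<bar>g x\<bar> \<le> C"
    and predictor: "\<And>Z c. Z \<in> borel_measurable past_field \<Longrightarrow> (\<And>x. \<bar>Z x\<bar> \<le> c) \<Longrightarrow>
      (\<integral>x. \<phi> (x 0) * Z x \<partial>\<nu>) = (\<integral>x. g x * Z x \<partial>\<nu>)"
    and m: "m \<ge> 1"
  shows "(\<integral>x. (\<phi> (x 0) - g x) * (\<phi> (jump m x 0) - g (jump m x)) \<partial>\<nu>) = 0"
proof -
  have C: "0 \<le> C" using bound[of 0] by simp
  define w where "w t x = (if t = 0 then 0 else \<phi> (x (- int t)) - g (time_shift (- int t) x))" for t x
  (* The value 0 for w at time 0 and for Z at infinity keeps Z past-measurable everywhere;
     for m >= 1 time 0 does not occur, and infinity has probability zero. *)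
  define Z where "Z x = (case return_time m x of enat t \<Rightarrow> w t x | \<infinity> \<Rightarrow> 0)" for x
  have w_past: "w t \<in> borel_measurable past_field" for t
  proof (cases "t = 0")
    case False
    then have [measurable]: "(\<lambda>x. x (- int t)) \<in> borel_measurable past_field"
      by (intro measurable_past_coordinate) simp
    have [measurable]: "(\<lambda>x. g (time_shift (- int t) x)) \<in> borel_measurable past_field"
      by (rule measurable_compose[OF measurable_shift_past_field g])
    show ?thesis unfolding w_def by measurable
  next
    case True
    then have "w t = (\<lambda>_. 0)" by (simp add: w_def fun_eq_iff)
    then show ?thesis by simp
  qed
  have Z_past: "Z \<in> borel_measurable past_field"
    unfolding Z_def using measurable_return_time_past[of m] w_past
    by (intro measurable_case_enat) auto
  have Z_bound: "\<bar>Z x\<bar> \<le> 2 * C" for x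
  proof (cases "return_time m x")
    case (enat t)
    then show ?thesis
      using bound[of "x (- int t)"] g_bound[of "time_shift (- int t) x"] C by (auto simp: Z_def w_def)
  qed (use C in \<open>simp add: Z_def\<close>)
  note [measurable] = measurable_from_past[OF Z_past] measurable_from_past[OF g]
  have "(\<integral>x. (\<phi> (x 0) - g x) * (\<phi> (jump m x 0) - g (jump m x)) \<partial>\<nu>) = (\<integral>x. (\<phi> (x 0) - g x) * Z x \<partial>\<nu>)"
  proof (rule integral_cong_AE)
    show "AE x in \<nu>. (\<phi> (x 0) - g x) * (\<phi> (jump m x 0) - g (jump m x)) = (\<phi> (x 0) - g x) * Z x"
      using AE_return_time_finite[of m]
    proof eventually_elim
      case (elim x)
      then obtain t where t: "return_time m x = enat t" by auto
      have "t \<noteq> 0"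
      proof
        assume "t = 0"
        have none: "{s\<in>{1..0::nat}. P s} = {}" for P by auto
        show False
          using t m unfolding \<open>t = 0\<close> return_time_def nth_hit_eq_enat_iff none by simp
      qed
      then show ?case using t by (simp add: Z_def w_def jump_def time_shift_def)
    qed
  qed measurable
  also have "\<dots> = (\<integral>x. \<phi> (x 0) * Z x - g x * Z x \<partial>\<nu>)"
    by (simp add: left_diff_distrib)
  also have "\<dots> = (\<integral>x. \<phi> (x 0) * Z x \<partial>\<nu>) - (\<integral>x. g x * Z x \<partial>\<nu>)"
  proof (rule Bochner_Integration.integral_diff)
    have "\<bar>\<phi> (x 0) * Z x\<bar> \<le> C * (2 * C)" "\<bar>g x * Z x\<bar> \<le> C * (2 * C)" for x
      unfolding abs_mult using bound[of "x 0"] g_bound[of x] Z_bound[of x] C by (auto intro!: mult_mono)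
    then show "integrable \<nu> (\<lambda>x. \<phi> (x 0) * Z x)" "integrable \<nu> (\<lambda>x. g x * Z x)"
      by (auto intro!: integrable_const_bound[where B="C * (2 * C)"])
  qed
  also have "\<dots> = 0" using predictor[OF Z_past Z_bound] by simp
  finally show ?thesis .
qed

end

section \<open>Consistency on path space\<close>

text \<open>The past is generated by cylinders over a single coordinate, with bases from any generator of the
Borel sets.\<close>

lemma sets_past_field_eq:
  assumes B: "sigma_sets UNIV \<C> = sets (borel :: real measure)" and G: "G \<subseteq> sets past_field"
    and cyl: "\<And>t B. t < 0 \<Longrightarrow> B \<in> \<C> \<Longrightarrow> {x. x t \<in> B} \<in> G"
  shows "sets past_field = sigma_sets UNIV G"
proof
  show "sigma_sets UNIV G \<subseteq> sets past_field"
    using sets.sigma_sets_subset[OF G] by simp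
  let ?S = "sigma UNIV G"
  have "(\<lambda>x. x) \<in> ?S \<rightarrow>\<^sub>M past_field"
  proof (rule measurable_into_past_fieldI)
    fix t :: int assume t: "t < 0"
    have "(\<lambda>x. x t) \<in> ?S \<rightarrow>\<^sub>M sigma UNIV \<C>"
    proof (rule measurable_measure_of)
      fix B assume "B \<in> \<C>"
      then have "{x. x t \<in> B} \<in> sets ?S" using cyl[OF t] by auto
      then show "(\<lambda>x. x t) -` B \<inter> space ?S \<in> sets ?S" by (simp add: vimage_def)
    qed auto
    also have "?S \<rightarrow>\<^sub>M sigma UNIV \<C> = borel_measurable ?S"
      by (rule measurable_cong_sets) (simp_all add: B)
    finally show "(\<lambda>x. x t) \<in> borel_measurable ?S" .
  qed
  then show "sets past_field \<subseteq> sigma_sets UNIV G"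
    using measurable_sets[of "\<lambda>x. x" ?S past_field] by auto
qed

context stationary_path_measure
begin

text \<open>A cylinder \<open>{x. x t \<in> B}\<close> with \<open>B\<close> in some \<open>\<B> i\<close> is a union of label classes as soon as the field
is fine enough and the block long enough, and it remains one from then on. Such sets are stable
under intersection and generate the past, so \<open>L1_dense_of_generator\<close> applies.\<close>

lemma approximation_by_labels:
  fixes \<B> :: "nat \<Rightarrow> real set set" and l :: "nat \<Rightarrow> nat" and g :: "(int \<Rightarrow> real) \<Rightarrow> real"
  assumes field: "\<And>i. i \<ge> 1 \<Longrightarrow> sigma_algebra UNIV (\<B> i)" "\<And>i. i \<ge> 1 \<Longrightarrow> finite (\<B> i)"
    and mono_B: "mono_on {1..} \<B>"
    and generate: "sigma_sets UNIV (\<Union>i\<in>{1..}. \<B> i) = sets borel"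
    and l: "mono_on {1..} l" "\<not> bdd_above (l ` {1..})"
    and g: "g \<in> borel_measurable past_field" "integrable \<nu> g" and e: "e > 0"
  obtains h i0 where "integrable \<nu> h" "(\<integral>x. \<bar>g x - h x\<bar> \<partial>\<nu>) < e" "i0 \<ge> 1"
    "\<And>i x y. i \<ge> i0 \<Longrightarrow> block_label (\<B> i) (l i) x = block_label (\<B> i) (l i) y \<Longrightarrow> h x = h y"
proof -
  define Inv where "Inv f \<longleftrightarrow> (\<exists>i0\<ge>1. \<forall>i\<ge>i0. \<forall>x y. 
    block_label (\<B> i) (l i) x = block_label (\<B> i) (l i) y \<longrightarrow> f x = f y)" for f :: "(int \<Rightarrow> real) \<Rightarrow> real"
  define V where "V f \<longleftrightarrow> integrable \<nu> f \<and> Inv f" for f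
  define G where "G = {A\<in>sets past_field. Inv (indicator A)}"
  (* The later of the two thresholds serves for both functions. *)
  have Inv_2: "Inv (\<lambda>x. F (f x) (g x))" if "Inv f" "Inv g" for f g F
  proof -
    obtain i where i: "i \<ge> 1" "\<And>j x y. j \<ge> i \<Longrightarrow> block_label (\<B> j) (l j) x = block_label (\<B> j) (l j) y \<Longrightarrow> f x = f y"
      using \<open>Inv f\<close> unfolding Inv_def by blast
    obtain i' where i': "i' \<ge> 1" "\<And>j x y. j \<ge> i' \<Longrightarrow> block_label (\<B> j) (l j) x = block_label (\<B> j) (l j) y \<Longrightarrow> g x = g y"
      using \<open>Inv g\<close> unfolding Inv_def by blast
    show ?thesis unfolding Inv_def
    proof (intro exI[of _ "max i i'"] conjI allI impI)
      fix j x y assume j: "max i i' \<le> j" and eq: "block_label (\<B> j) (l j) x = block_label (\<B> j) (l j) y"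
      then show "F (f x) (g x) = F (f y) (g y)"
        using i(2)[of j x y] i'(2)[of j x y] by simp
    qed (use i in simp)
  qed
  have Inv_const: "Inv (\<lambda>_. a)" for a unfolding Inv_def by auto
  have cyl: "{x. x t \<in> B} \<in> G" if t: "t < 0" and B: "B \<in> (\<Union>i\<in>{1..}. \<B> i)" for t B
  proof -
    obtain i1 where i1: "i1 \<ge> 1" "B \<in> \<B> i1" using B by auto
    obtain i2 where i2: "i2 \<ge> 1" "nat (- t) \<le> l i2"
      using l(2) unfolding bdd_above_def by (auto simp: not_le) (meson atLeast_iff less_imp_le)
    have "B \<in> sets borel" using B generate by (metis sigma_sets.Basic)
    then have "{x. x t \<in> B} \<in> sets past_field"
      using measurable_sets[OF measurable_past_coordinate[OF t], of B] by (simp add: vimage_def)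
    moreover have "Inv (indicator {x. x t \<in> B})"
      unfolding Inv_def
    proof (intro exI[of _ "max i1 i2"] conjI allI impI)
      fix i x y assume i: "max i1 i2 \<le> i" and eq: "block_label (\<B> i) (l i) x = block_label (\<B> i) (l i) y"
      have i_pos: "i \<ge> 1" using i i1 by simp
      have "l i2 \<le> l i" using i i2 i_pos by (intro mono_onD[OF l(1)]) auto
      with i2(2) have "nat (- t) \<le> l i" by (rule order_trans)
      then have mem: "nat (- t) \<in> {1..l i}" using t by simp
      have "- int (nat (- t)) = t" using t by simp
      with fun_cong[OF eq, of "nat (- t)"] mem have same_atom: "atom_of (\<B> i) (x t) = atom_of (\<B> i) (y t)"
        unfolding block_label_def by (simp only: restrict_apply' if_True)
      have "B \<in> \<B> i"
        using mono_onD[OF mono_B, of i1 i] i i1 i_pos by auto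
      then have "x t \<in> B \<longleftrightarrow> y t \<in> B"
        by (rule atom_of_eq_imp_mem_iff[OF field[OF i_pos] _ same_atom])
      then show "indicator {x. x t \<in> B} x = (indicator {x. x t \<in> B} y :: real)"
        by (simp add: indicator_def)
    qed (use i1 in simp)
    ultimately show ?thesis by (simp add: G_def)
  qed
  have G_sets: "sets past_field = sigma_sets (space \<nu>) G"
    using sets_past_field_eq[OF generate _ cyl] by (simp add: G_def)
  have G_Int: "Int_stable G"
  proof (rule Int_stableI)
    fix A B assume "A \<in> G" "B \<in> G"
    moreover have "(\<lambda>x. indicator A x * indicator B x :: real) = indicator (A \<inter> B)"
      by (rule ext) (simp add: indicator_inter_arith)
    ultimately show "A \<inter> B \<in> G"
      using Inv_2[of "indicator A" "indicator B" "(*)"] by (simp add: G_def sets.Int)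
  qed
  have past_sets: "A \<in> sets \<nu>" if "A \<in> sets past_field" for A
    using subalgebra_past that by (auto simp: subalgebra_def)
  obtain h where h: "V h" "(\<integral>x. \<bar>g x - h x\<bar> \<partial>\<nu>) < e"
  proof (rule L1_dense_of_generator[OF subalgebra_past G_Int G_sets _ _ _ _ _ g e, of V])
    show "V (\<lambda>x. f x + f' x)" if "V f" "V f'" for f f'
      using that Inv_2[of f f' "(+)"] by (simp add: V_def)
    show "V (\<lambda>x. a * f x)" if "V f" for f a
      using that Inv_2[of f f "\<lambda>u _. a * u"] by (simp add: V_def)
    show "V (\<lambda>x. 1)" using Inv_const by (simp add: V_def)
    show "V (indicator A)" if "A \<in> G" for A
      using that past_sets[of A] by (simp add: V_def G_def less_top[symmetric])
  qed (auto simp: V_def)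
  then show thesis using that unfolding V_def Inv_def by meson
qed

end

text \<open>The setting of the consistency theorem, with the law on path space in place of the process.\<close>

locale forecasting_scheme = stationary_path_measure \<nu> for \<nu> +
  fixes \<B> :: "nat \<Rightarrow> real set set" and l J k :: "nat \<Rightarrow> nat" and \<epsilon> :: "nat \<Rightarrow> real" and Q :: "real measure"
  assumes fields: "\<And>i. i \<ge> 1 \<Longrightarrow> sigma_algebra UNIV (\<B> i)" "\<And>i. i \<ge> 1 \<Longrightarrow> finite (\<B> i)"
    and mono_B: "mono_on {1..} \<B>"
    and generate: "sigma_sets UNIV (\<Union>i\<in>{1..}. \<B> i) = sets borel"
    and l: "mono_on {1..} l" "\<not> bdd_above (l ` {1..})"
    and J_pos: "\<And>i. i \<ge> 1 \<Longrightarrow> J i \<ge> 1" and J: "mono_on {1..} J" "\<not> bdd_above (J ` {1..})"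
    and k_pos: "\<And>n. k n \<ge> 1" and k: "mono k" "\<not> bdd_above (range k)"
    and \<epsilon>_pos: "\<And>i. i \<ge> 1 \<Longrightarrow> \<epsilon> i > 0" and \<epsilon>: "\<epsilon> \<longlonglongrightarrow> 0"
    and growth: "eventually (\<lambda>n. real n \<ge> real (l (k n)) +
           real (J (k n)) * real (card (atoms (\<B> (k n)))) ^ l (k n) / \<epsilon> (k n)) sequentially"
    and Q: "prob_space Q" "sets Q = sets borel"
begin

lemma quantized:
  assumes "i \<ge> 1"
  shows "quantized_paths \<nu> (\<B> i)"
proof (intro quantized_paths.intro quantized_paths_axioms.intro)
  show "stationary_path_measure \<nu>" ..
  show "sigma_algebra UNIV (\<B> i)" "finite (\<B> i)" using fields assms by auto
  show "\<B> i \<subseteq> sets borel"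
    using generate sigma_sets.Basic[of _ "\<Union>i\<in>{1..}. \<B> i" UNIV] assms by auto
qed

lemma k_at_top: "filterlim k at_top sequentially"
proof (rule filterlim_at_top[THEN iffD2, rule_format])
  fix N
  obtain n where n: "k n > N" using k(2) unfolding bdd_above_def by (auto simp: not_le)
  show "eventually (\<lambda>m. N \<le> k m) sequentially"
    unfolding eventually_sequentially
  proof (intro exI allI impI)
    fix m assume "n \<le> m"
    then show "N \<le> k m" using n monoD[OF k(1), of n m] by simp
  qed
qed

lemma J_at_top: "filterlim J at_top sequentially"
proof (rule filterlim_at_top[THEN iffD2, rule_format])
  fix N
  obtain n where n: "J n > N" "n \<ge> 1" using J(2) unfolding bdd_above_def by (auto simp: not_le)
  show "eventually (\<lambda>m. N \<le> J m) sequentially"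
    unfolding eventually_sequentially
  proof (intro exI allI impI)
    fix m assume "n \<le> m"
    then show "N \<le> J m" using n mono_onD[OF J(1), of n m] by simp
  qed
qed

abbreviation failure :: "nat \<Rightarrow> (int \<Rightarrow> real) set" where
  "failure n \<equiv> {x. \<not> memory_length (\<B> (k n)) (l (k n)) (J (k n)) x \<le> enat n}"

lemma failure_sets [measurable]: "failure n \<in> sets \<nu>"
proof -
  interpret quantized_paths \<nu> "\<B> (k n)" "l (k n)" by (rule quantized[OF k_pos])
  have "{x\<in>space \<nu>. \<not> enat (l (k n)) + return_time (J (k n)) x \<le> enat n} \<in> sets \<nu>" by measurable
  then show ?thesis by (simp add: memory_length_def return_time_eq)
qed

text \<open>There are at most \<open>|\<Xi>|\<^sup>l\<close> labels, so the assumed growth of \<open>n\<close> is exactly what makes the Markov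
bound at most \<open>\<epsilon> (k n)\<close>.\<close>

lemma prob_failure_tendsto_0: "(\<lambda>n. measure \<nu> (failure n)) \<longlonglongrightarrow> 0"
proof (rule tendsto_sandwich[where f="\<lambda>_. 0" and h="\<lambda>n. \<epsilon> (k n)"])
  show "eventually (\<lambda>n. measure \<nu> (failure n) \<le> \<epsilon> (k n)) sequentially"
    using growth
  proof eventually_elim
    case (elim n)
    interpret quantized_paths \<nu> "\<B> (k n)" "l (k n)" by (rule quantized[OF k_pos])
    let ?N = "card (atoms (\<B> (k n))) ^ l (k n)"
    have N_le: "card (range (block_label (\<B> (k n)) (l (k n)))) \<le> ?N"
      by (rule card_range_block_label_le[OF fields[OF k_pos]])
    have "0 < card (range (block_label (\<B> (k n)) (l (k n))))"
      using finite_labels by (simp add: card_gt_0_iff)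
    then have N_pos: "?N > 0" using N_le by (rule less_le_trans)
    have eps: "\<epsilon> (k n) > 0" using \<epsilon>_pos k_pos by simp
    have "real (J (k n)) * real ?N > 0" using J_pos[OF k_pos[of n]] N_pos by simp
    then have q_pos: "real (J (k n)) * real ?N / \<epsilon> (k n) > 0" using eps by simp
    have elim': "real n \<ge> real (l (k n)) + real (J (k n)) * real ?N / \<epsilon> (k n)" using elim by simp
    then have n: "l (k n) < n" using q_pos by linarith
    define r where "r = n - l (k n)"
    have r: "r > 0" "real r \<ge> real (J (k n)) * real ?N / \<epsilon> (k n)"
      using n elim' by (simp_all add: r_def of_nat_diff)
    have "failure n = {x\<in>space \<nu>. \<not> return_time (J (k n)) x \<le> enat r}"
    proof -
      have "enat (l (k n)) + u \<le> enat n \<longleftrightarrow> u \<le> enat r" for u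
        using n unfolding r_def by (cases u) auto
      then show ?thesis by (simp add: memory_length_def return_time_eq)
    qed
    then have "measure \<nu> (failure n) \<le> real (J (k n) * card (range (block_label (\<B> (k n)) (l (k n))))) / real r"
      using prob_return_time_gt_le[OF r(1)] by simp
    also have "\<dots> \<le> real (J (k n)) * real ?N / real r"
      using N_le by (intro divide_right_mono) (simp_all only: of_nat_mult mult_left_mono of_nat_0_le_iff of_nat_le_iff)
    also have "\<dots> \<le> \<epsilon> (k n)"
      using r eps by (simp add: field_simps)
    finally show ?case .
  qed
  show "(\<lambda>n. \<epsilon> (k n)) \<longlonglongrightarrow> 0"
    by (rule filterlim_compose[OF \<epsilon> k_at_top])
qed auto

text \<open>The integral of \<open>\<phi>\<close> under the untruncated estimate of stage \<open>i\<close>.\<close>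

definition block_average :: "(real \<Rightarrow> real) \<Rightarrow> nat \<Rightarrow> (int \<Rightarrow> real) \<Rightarrow> real" where
  "block_average \<phi> i x = (\<Sum>j=1..J i. \<phi> (x (- int (the_enat (recurrence_time (\<B> i) (l i) x j))))) / real (J i)"

lemma block_average_measurable:
  assumes i: "i \<ge> 1" and [measurable]: "\<phi> \<in> borel_measurable borel"
  shows "block_average \<phi> i \<in> borel_measurable \<nu>"
proof -
  interpret quantized_paths \<nu> "\<B> i" "l i" by (rule quantized[OF i])
  have "(\<lambda>x. (\<Sum>j=1..J i. \<phi> (jump j x 0)) / real (J i)) \<in> borel_measurable \<nu>" by measurable
  then show ?thesis unfolding block_average_def by (simp add: jump_0)
qed

lemma block_average_bound:
  assumes "\<And>y. \<bar>\<phi> y\<bar> \<le> C"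
  shows "\<bar>block_average \<phi> i x\<bar> \<le> C"
proof -
  have C: "0 \<le> C" using assms[of 0] by simp
  have "\<bar>\<Sum>j=1..J i. \<phi> (x (- int (the_enat (recurrence_time (\<B> i) (l i) x j))))\<bar> \<le> (\<Sum>j=1..J i. C)"
    by (intro order_trans[OF sum_abs] sum_mono assms)
  then have "\<bar>block_average \<phi> i x\<bar> \<le> real (J i) * C / real (J i)"
    unfolding block_average_def abs_divide abs_of_nat by (intro divide_right_mono) simp_all
  also have "\<dots> \<le> C" using C by simp
  finally show ?thesis .
qed

lemma block_average_tendsto:
  fixes \<phi> :: "real \<Rightarrow> real"
  assumes \<phi> [measurable]: "\<phi> \<in> borel_measurable borel" and bound: "\<And>y. \<bar>\<phi> y\<bar> \<le> C"
    and g: "g \<in> borel_measurable past_field" and g_bound: "\<And>x. \<bar>g x\<bar> \<le> C"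
    and predictor: "\<And>Z c. Z \<in> borel_measurable past_field \<Longrightarrow> (\<And>x. \<bar>Z x\<bar> \<le> c) \<Longrightarrow>
      (\<integral>x. \<phi> (x 0) * Z x \<partial>\<nu>) = (\<integral>x. g x * Z x \<partial>\<nu>)"
  shows "(\<lambda>i. \<integral>x. \<bar>block_average \<phi> i x - g x\<bar> \<partial>\<nu>) \<longlonglongrightarrow> 0"
proof (rule tendstoI)
  fix e :: real assume "e > 0"
  then have e: "e / 4 > 0" by simp
  note [measurable] = measurable_from_past[OF g]
  have g_int: "integrable \<nu> g" using g_bound by (intro integrable_const_bound[where B=C]) auto
  obtain h i0 where h: "integrable \<nu> h" "(\<integral>x. \<bar>g x - h x\<bar> \<partial>\<nu>) < e / 4" "i0 \<ge> 1"
    "\<And>i x y. i \<ge> i0 \<Longrightarrow> block_label (\<B> i) (l i) x = block_label (\<B> i) (l i) y \<Longrightarrow> h x = h y"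
    by (rule approximation_by_labels[OF fields mono_B generate l g g_int e]) (assumption, assumption, rule that)
  have "filterlim (\<lambda>i. sqrt (real (J i))) at_top sequentially"
    by (rule filterlim_compose[OF sqrt_at_top filterlim_compose[OF filterlim_real_sequentially J_at_top]])
  then have "(\<lambda>i. 2 * C / sqrt (real (J i))) \<longlonglongrightarrow> 0"
    by (rule real_tendsto_divide_at_top[OF tendsto_const])
  then have "eventually (\<lambda>i. 2 * C / sqrt (real (J i)) < e / 4) sequentially"
    using e by (rule order_tendstoD(2))
  moreover have "eventually (\<lambda>i. i \<ge> i0) sequentially" by (rule eventually_ge_at_top)
  ultimately show "eventually (\<lambda>i. dist (\<integral>x. \<bar>block_average \<phi> i x - g x\<bar> \<partial>\<nu>) 0 < e) sequentially"
  proof eventually_elim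
    case (elim i)
    then have i: "i \<ge> 1" using h(3) by simp
    interpret quantized_paths \<nu> "\<B> i" "l i" by (rule quantized[OF i])
    have "(\<integral>x. \<bar>(\<Sum>j=1..J i. \<phi> (jump j x 0)) / real (J i) - g x\<bar> \<partial>\<nu>)
        \<le> 2 * C / sqrt (real (J i)) + 2 * (\<integral>x. \<bar>g x - h x\<bar> \<partial>\<nu>)"
    proof (rule integral_abs_average_error_le[where \<phi>="\<lambda>x. \<phi> (x 0)"])
      show "(\<integral>x. (\<phi> (x 0) - g x) * (\<phi> (jump m x 0) - g (jump m x)) \<partial>\<nu>) = 0" if "m \<ge> 1" for m
        by (rule innovation_orthogonal[OF \<phi> bound g g_bound predictor that])
      show "block_label (\<B> i) (l i) x = block_label (\<B> i) (l i) y \<Longrightarrow> h x = h y" for x y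
        by (rule h(4)[OF elim(2)])
    qed (use bound g_bound h(1) J_pos[OF i] in auto)
    then have "(\<integral>x. \<bar>block_average \<phi> i x - g x\<bar> \<partial>\<nu>) < e"
      using elim(1) h(2) \<open>e > 0\<close> unfolding block_average_def jump_0 by linarith
    then show ?case by simp
  qed
qed

lemma integral_truncated_estimate:
  fixes \<phi> :: "real \<Rightarrow> real"
  assumes [measurable]: "\<phi> \<in> borel_measurable borel"
  shows "(\<integral>y. \<phi> y \<partial>truncated_estimate \<B> l J k Q n x) =
    (if x \<in> failure n then (\<integral>y. \<phi> y \<partial>Q) else block_average \<phi> (k n) x)"
proof -
  have "(\<integral>y. \<phi> y \<partial>empirical_distr m \<xi>) = (\<Sum>j=1..m. \<phi> (\<xi> j)) / real m" for m \<xi>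
  proof -
    have "(\<integral>y. \<phi> y \<partial>empirical_distr m \<xi>) = (\<integral>j. \<phi> (\<xi> j) \<partial>uniform_count_measure {1..m})"
      unfolding empirical_distr_def
    proof (rule integral_distr)
      show "\<xi> \<in> uniform_count_measure {1..m} \<rightarrow>\<^sub>M borel"
        by (simp add: measurable_def space_uniform_count_measure sets_uniform_count_measure)
    qed fact
    then show ?thesis by (simp add: integral_uniform_count_measure)
  qed
  then show ?thesis
    by (simp add: truncated_estimate_def recurrence_estimate_def block_average_def)
qed

lemma Q_integral_bound:
  fixes \<phi> :: "real \<Rightarrow> real"
  assumes [measurable]: "\<phi> \<in> borel_measurable borel" and bound: "\<And>y. \<bar>\<phi> y\<bar> \<le> C"
  shows "\<bar>\<integral>y. \<phi> y \<partial>Q\<bar> \<le> C"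
  using Q by (intro prob_space.abs_expectation_le[OF Q(1)] bound) (simp cong: measurable_cong_sets)

text \<open>Off the failure event the estimate is the block average; on it the error is at most \<open>2 C\<close>, and its
probability tends to 0.\<close>

lemma truncated_estimate_tendsto_L1:
  fixes \<phi> :: "real \<Rightarrow> real"
  assumes \<phi> [measurable]: "\<phi> \<in> borel_measurable borel" and bound: "\<And>y. \<bar>\<phi> y\<bar> \<le> C"
    and g: "g \<in> borel_measurable past_field" and g_bound: "\<And>x. \<bar>g x\<bar> \<le> C"
    and predictor: "\<And>Z c. Z \<in> borel_measurable past_field \<Longrightarrow> (\<And>x. \<bar>Z x\<bar> \<le> c) \<Longrightarrow>
      (\<integral>x. \<phi> (x 0) * Z x \<partial>\<nu>) = (\<integral>x. g x * Z x \<partial>\<nu>)"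
  shows "tendsto_L1 \<nu> (\<lambda>n x. \<integral>y. \<phi> y \<partial>truncated_estimate \<B> l J k Q n x) g"
proof -
  let ?q = "\<integral>y. \<phi> y \<partial>Q"
  let ?A = "\<lambda>n x. if x \<in> failure n then ?q else block_average \<phi> (k n) x"
  note [measurable] = measurable_from_past[OF g] block_average_measurable[OF k_pos \<phi>]
  have C: "0 \<le> C" using bound[of 0] by simp
  have g_int: "integrable \<nu> g" using g_bound by (intro integrable_const_bound[where B=C]) auto
  have av_int: "integrable \<nu> (block_average \<phi> (k n))" for n
    using block_average_bound[OF bound] by (intro integrable_const_bound[where B=C]) auto
  have A_meas [measurable]: "?A n \<in> borel_measurable \<nu>" for n by measurable
  have A_int: "integrable \<nu> (?A n)" for n
  proof (rule integrable_const_bound[where B=C])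
    show "AE x in \<nu>. norm (?A n x) \<le> C"
      using block_average_bound[where \<phi>=\<phi>, OF bound] Q_integral_bound[OF \<phi> bound] by (intro AE_I2) simp
  qed (rule A_meas)
  have "(\<lambda>n. \<integral>x. \<bar>?A n x - g x\<bar> \<partial>\<nu>) \<longlonglongrightarrow> 0"
  proof (rule tendsto_sandwich[where f="\<lambda>_. 0"])
    let ?u = "\<lambda>n. (\<integral>x. \<bar>block_average \<phi> (k n) x - g x\<bar> \<partial>\<nu>) + 2 * C * measure \<nu> (failure n)"
    show "eventually (\<lambda>n. (\<integral>x. \<bar>?A n x - g x\<bar> \<partial>\<nu>) \<le> ?u n) sequentially"
    proof (rule always_eventually, rule allI)
      fix n
      have "(\<integral>x. \<bar>?A n x - g x\<bar> \<partial>\<nu>)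
          \<le> (\<integral>x. \<bar>block_average \<phi> (k n) x - g x\<bar> + 2 * C * indicator (failure n) x \<partial>\<nu>)"
      proof (rule integral_mono)
        fix x
        show "\<bar>?A n x - g x\<bar> \<le> \<bar>block_average \<phi> (k n) x - g x\<bar> + 2 * C * indicator (failure n) x"
          using Q_integral_bound[OF \<phi> bound] g_bound[of x] by (cases "x \<in> failure n") (auto simp: indicator_def)
      qed (use A_int g_int av_int in \<open>auto simp: less_top[symmetric]\<close>)
      also have "\<dots> = ?u n"
        using av_int g_int by (simp add: less_top[symmetric])
      finally show "(\<integral>x. \<bar>?A n x - g x\<bar> \<partial>\<nu>) \<le> ?u n" .
    qed
    have "(\<lambda>n. \<integral>x. \<bar>block_average \<phi> (k n) x - g x\<bar> \<partial>\<nu>) \<longlonglongrightarrow> 0"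
      by (rule filterlim_compose[OF block_average_tendsto[OF \<phi> bound g g_bound predictor] k_at_top])
    from tendsto_add[OF this tendsto_mult[OF tendsto_const prob_failure_tendsto_0, of "2 * C"]]
    show "?u \<longlonglongrightarrow> 0" by simp
  qed auto
  then show ?thesis
    unfolding tendsto_L1_def integral_truncated_estimate[OF \<phi>] using A_int g_int by simp
qed

end

section \<open>From the law to the process\<close>

text \<open>The kernel is only known to represent the conditional probabilities of single Borel sets. For \<open>A\<close>
in \<open>F\<close> this says that \<open>Y\<close> distributed under \<open>M\<close> restricted to \<open>A\<close>, and the mixture of the kernel
over \<open>A\<close>, are the same measure; hence they also integrate \<open>\<phi>\<close> equally.\<close>

lemma regular_cond_distr_integral:
  fixes \<phi> :: "real \<Rightarrow> real"
  assumes M: "prob_space M" and F: "subalgebra M F" and Y [measurable]: "Y \<in> borel_measurable M"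
    and K: "regular_cond_distr M F Y K"
    and \<phi> [measurable]: "\<phi> \<in> borel_measurable borel" and bound: "\<And>y. \<bar>\<phi> y\<bar> \<le> C"
  shows "(\<lambda>\<omega>. \<integral>y. \<phi> y \<partial>K \<omega>) \<in> borel_measurable F"
    and "AE \<omega> in M. real_cond_exp M F (\<lambda>\<omega>. \<phi> (Y \<omega>)) \<omega> = (\<integral>y. \<phi> y \<partial>K \<omega>)"
proof -
  interpret prob_space M by (rule M)
  interpret sigma_finite_subalgebra M F
    by (intro finite_measure_subalgebra_is_sigma_finite finite_measure_subalgebra.intro
        finite_measure_subalgebra_axioms.intro F) unfold_locales
  have C: "0 \<le> C" using bound[of 0] by simp
  have K_F: "K \<in> F \<rightarrow>\<^sub>M prob_algebra borel"
    and K_exp: "\<And>B. B \<in> sets borel \<Longrightarrow>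
      AE \<omega> in M. measure (K \<omega>) B = real_cond_exp M F (\<lambda>\<omega>. indicator B (Y \<omega>)) \<omega>"
    using K by (auto simp: regular_cond_distr_def)
  have K_sub [measurable]: "K \<in> F \<rightarrow>\<^sub>M subprob_algebra borel"
    using K_F by (rule measurable_prob_algebraD)
  have K_M [measurable]: "K \<in> M \<rightarrow>\<^sub>M subprob_algebra borel"
    by (rule measurable_from_subalg[OF F K_sub])
  show int_F [measurable]: "(\<lambda>\<omega>. \<integral>y. \<phi> y \<partial>K \<omega>) \<in> borel_measurable F"
    by (rule measurable_compose[OF K_sub integral_measurable_subprob_algebra[OF \<phi>]])
  have spaceF: "space F = space M" using F by (simp add: subalgebra_def)
  have K_prob: "prob_space (K \<omega>)" if "\<omega> \<in> space M" for \<omega>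
    using measurable_space[OF K_F, of \<omega>] that spaceF by (auto simp: space_prob_algebra)
  show "AE \<omega> in M. real_cond_exp M F (\<lambda>\<omega>. \<phi> (Y \<omega>)) \<omega> = (\<integral>y. \<phi> y \<partial>K \<omega>)"
  proof (rule real_cond_exp_charact)
    show "integrable M (\<lambda>\<omega>. \<phi> (Y \<omega>))"
      using bound by (intro integrable_const_bound[where B=C]) auto
    have "AE \<omega> in M. norm (\<integral>y. \<phi> y \<partial>K \<omega>) \<le> C"
    proof (rule AE_I2)
      fix \<omega> assume \<omega>: "\<omega> \<in> space M"
      then have "sets (K \<omega>) = sets borel" by (rule sets_kernel[OF K_M])
      then show "norm (\<integral>y. \<phi> y \<partial>K \<omega>) \<le> C"
        unfolding real_norm_def
        by (intro prob_space.abs_expectation_le[OF K_prob[OF \<omega>]] bound) (simp cong: measurable_cong_sets)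
    qed
    then show "integrable M (\<lambda>\<omega>. \<integral>y. \<phi> y \<partial>K \<omega>)"
      by (rule integrable_const_bound) (rule measurable_from_subalg[OF F int_F])
    fix A assume A_F: "A \<in> sets F"
    then have A [measurable]: "A \<in> sets M" using F by (auto simp: subalgebra_def)
    define MA where "MA = density M (\<lambda>\<omega>. ennreal (indicator A \<omega>))"
    have sets_MA [measurable_cong, simp]: "sets MA = sets M" and space_MA [simp]: "space MA = space M"
      by (simp_all add: MA_def)
    have MA_emeasure: "emeasure MA S = emeasure M (A \<inter> S)" if "S \<in> sets M" for S
      unfolding MA_def using that
      by (subst emeasure_density) (auto simp: nn_integral_indicator[symmetric] indicator_inter_arith
          intro!: nn_integral_cong simp del: nn_integral_indicator simp: indicator_def)
    have MA_fin: "finite_measure MA"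
      by (rule finite_measureI) (simp add: MA_emeasure)
    have "distr MA borel Y = MA \<bind> K"
    proof (rule measure_eqI)
      have [simp]: "sets (MA \<bind> K) = sets borel"
        using not_empty by (intro sets_bind[where N=borel]) (auto dest: sets_kernel[OF K_M])
      then show "sets (distr MA borel Y) = sets (MA \<bind> K)" by simp
      fix B assume "B \<in> sets (distr MA borel Y)"
      then have B [measurable]: "B \<in> sets borel" by simp
      have ind_int: "integrable M (\<lambda>\<omega>. indicator A \<omega> * indicator B (Y \<omega>) :: real)"
        by (intro integrable_const_bound[where B=1]) (auto simp: indicator_def)
      have KB [measurable]: "(\<lambda>\<omega>. measure (K \<omega>) B) \<in> borel_measurable M"
        unfolding measure_def by measurable
      have KB_int: "integrable M (\<lambda>\<omega>. indicator A \<omega> * measure (K \<omega>) B)"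
        using prob_space.prob_le_1[OF K_prob] by (intro integrable_const_bound[where B=1]) (auto simp: indicator_def)
      have "emeasure (MA \<bind> K) B = (\<integral>\<^sup>+\<omega>. emeasure (K \<omega>) B \<partial>MA)"
        using not_empty by (intro emeasure_bind[where N=borel]) auto
      also have "\<dots> = (\<integral>\<^sup>+\<omega>. ennreal (indicator A \<omega>) * emeasure (K \<omega>) B \<partial>M)"
        unfolding MA_def by (intro nn_integral_density) measurable
      also have "\<dots> = (\<integral>\<^sup>+\<omega>. ennreal (indicator A \<omega> * measure (K \<omega>) B) \<partial>M)"
      proof (rule nn_integral_cong)
        fix \<omega> assume "\<omega> \<in> space M"
        then interpret K\<omega>: prob_space "K \<omega>" by (rule K_prob)
        show "ennreal (indicator A \<omega>) * emeasure (K \<omega>) B = ennreal (indicator A \<omega> * measure (K \<omega>) B)"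
          by (simp add: K\<omega>.emeasure_eq_measure ennreal_mult)
      qed
      also have "\<dots> = ennreal (\<integral>\<omega>. indicator A \<omega> * measure (K \<omega>) B \<partial>M)"
        by (rule nn_integral_eq_integral[OF KB_int]) simp
      also have "(\<integral>\<omega>. indicator A \<omega> * measure (K \<omega>) B \<partial>M) =
          (\<integral>\<omega>. indicator A \<omega> * real_cond_exp M F (\<lambda>\<omega>. indicator B (Y \<omega>)) \<omega> \<partial>M)"
        using K_exp[OF B] by (intro integral_cong_AE) auto
      also have "\<dots> = (\<integral>\<omega>. indicator A \<omega> * indicator B (Y \<omega>) \<partial>M)"
        using A_F by (intro real_cond_exp_intg ind_int) auto
      also have "ennreal \<dots> = (\<integral>\<^sup>+\<omega>. ennreal (indicator A \<omega> * indicator B (Y \<omega>)) \<partial>M)"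
        by (rule nn_integral_eq_integral[symmetric, OF ind_int]) simp
      also have "\<dots> = (\<integral>\<^sup>+\<omega>. indicator (A \<inter> (Y -` B \<inter> space M)) \<omega> \<partial>M)"
        by (intro nn_integral_cong) (auto simp: indicator_def)
      also have "\<dots> = emeasure (distr MA borel Y) B"
        by (simp add: emeasure_distr MA_emeasure)
      finally show "emeasure (distr MA borel Y) B = emeasure (MA \<bind> K) B" by simp
    qed
    then have "(\<integral>\<omega>. \<phi> (Y \<omega>) \<partial>MA) = (\<integral>y. \<phi> y \<partial>(MA \<bind> K))"
      by (metis integral_distr \<phi> Y measurable_cong_sets sets_MA)
    also have "\<dots> = (\<integral>\<omega>. \<integral>y. \<phi> y \<partial>K \<omega> \<partial>MA)"
    proof (rule integral_bind[OF \<phi> _ _ MA_fin])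
      show "AE \<omega> in MA. emeasure (K \<omega>) (space (K \<omega>)) \<le> ennreal 1"
        using prob_space.emeasure_space_1[OF K_prob] by (intro AE_I2) simp
    qed (use bound in auto)
    finally show "(\<integral>\<omega>\<in>A. \<phi> (Y \<omega>) \<partial>M) = (\<integral>\<omega>\<in>A. (\<integral>y. \<phi> y \<partial>K \<omega>) \<partial>M)"
      using measurable_from_subalg[OF F int_F] unfolding MA_def set_lebesgue_integral_def
      by (simp add: integral_density)
  qed (rule int_F)
qed

locale stationary_process = prob_space M for M :: "'a measure" +
  fixes X :: "int \<Rightarrow> 'a \<Rightarrow> real"
  assumes measurable_X [measurable]: "\<And>t. X t \<in> borel_measurable M"
    and stationary: "stationary M X"
begin

abbreviation path :: "'a \<Rightarrow> int \<Rightarrow> real" where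
  "path \<omega> \<equiv> \<lambda>t. X t \<omega>"

lemma measurable_path [measurable]: "path \<in> M \<rightarrow>\<^sub>M path_space"
  by (rule measurable_PiM_single') auto

lemma stationary_path_measure_law: "stationary_path_measure (law M X)"
proof (intro stationary_path_measure.intro stationary_path_measure_axioms.intro)
  show "prob_space (law M X)"
    unfolding law_def by (rule prob_space_distr) measurable
  show "sets (law M X) = sets path_space" by (simp add: law_def)
  have [measurable]: "(\<lambda>x t. x (t + 1)) \<in> path_space \<rightarrow>\<^sub>M path_space"
    using measurable_shift_path_space[of 1] by (simp add: time_shift_def[abs_def])
  have "distr (law M X) path_space (\<lambda>x t. x (t + 1)) = law M (\<lambda>t. X (t + 1))"
    unfolding law_def by (subst distr_distr) (simp_all add: comp_def)
  then show "distr (law M X) path_space (\<lambda>x t. x (t + 1)) = law M X"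
    using stationary by (simp add: stationary_def)
qed

sublocale law: stationary_path_measure "law M X"
  by (rule stationary_path_measure_law)

lemma integral_law:
  fixes f :: "(int \<Rightarrow> real) \<Rightarrow> real"
  assumes "f \<in> borel_measurable (law M X)"
  shows "(\<integral>x. f x \<partial>law M X) = (\<integral>\<omega>. f (path \<omega>) \<partial>M)"
  using assms unfolding law_def by (subst integral_distr) simp_all

lemma subalgebra_past_algebra: "subalgebra M (past_algebra M X)"
  unfolding subalgebra_def
proof
  show "space (past_algebra M X) = space M" by (simp add: past_algebra_def)
  have "(\<lambda>\<omega>. \<omega>) \<in> M \<rightarrow>\<^sub>M past_algebra M X"
    unfolding past_algebra_def by (rule measurable_vimage_algebra2) auto
  note id_sets = measurable_sets[OF this]
  show "sets (past_algebra M X) \<subseteq> sets M"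
  proof
    fix A assume A: "A \<in> sets (past_algebra M X)"
    then have "A \<subseteq> space M" using sets.sets_into_space[OF A] by (simp add: past_algebra_def)
    then show "A \<in> sets M" using id_sets[OF A] by (simp add: Int_absorb2)
  qed
qed

lemma past_algebra_set_eq:
  assumes "A \<in> sets (past_algebra M X)"
  obtains A' where "A' \<in> sets past_field" "A = path -` A' \<inter> space M"
proof -
  obtain S where S: "S \<in> sets (Pi\<^sub>M {..<0} (\<lambda>_. borel))" "A = (\<lambda>\<omega>. \<lambda>t\<in>{..<0}. X t \<omega>) -` S \<inter> space M"
    using assms unfolding past_algebra_def by (subst (asm) sets_vimage_algebra2) (auto simp: space_PiM)
  define A' where "A' = (\<lambda>x. \<lambda>t\<in>{..<0}. x t) -` S \<inter> (UNIV :: (int \<Rightarrow> real) set)"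
  have "A' \<in> sets past_field"
    unfolding past_algebra_def A'_def space_path_space using S(1) by (rule in_vimage_algebra)
  moreover have "A = path -` A' \<inter> space M" using S(2) by (auto simp: A'_def)
  ultimately show thesis by (rule that)
qed

text \<open>Both sides are versions of the conditional expectation of \<open>\<phi>(X\<^sub>0)\<close> given the past of the process:
events of that past are preimages of events of \<open>past_field\<close> under the path map.\<close>

lemma predictor_eq_cond_integral:
  fixes \<phi> :: "real \<Rightarrow> real"
  assumes K: "regular_cond_distr M (past_algebra M X) (X 0) K"
    and \<phi> [measurable]: "\<phi> \<in> borel_measurable borel" and bound: "\<And>y. \<bar>\<phi> y\<bar> \<le> C"
    and g: "g \<in> borel_measurable past_field" and g_bound: "\<And>x. \<bar>g x\<bar> \<le> C"
    and predictor: "\<And>Z c. Z \<in> borel_measurable past_field \<Longrightarrow> (\<And>x. \<bar>Z x\<bar> \<le> c) \<Longrightarrow>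
      (\<integral>x. \<phi> (x 0) * Z x \<partial>law M X) = (\<integral>x. g x * Z x \<partial>law M X)"
  shows "AE \<omega> in M. (\<integral>y. \<phi> y \<partial>K \<omega>) = g (path \<omega>)"
proof -
  let ?F = "past_algebra M X"
  interpret sigma_finite_subalgebra M ?F
    by (intro finite_measure_subalgebra_is_sigma_finite finite_measure_subalgebra.intro
        finite_measure_subalgebra_axioms.intro subalgebra_past_algebra) unfold_locales
  have path_F: "path \<in> ?F \<rightarrow>\<^sub>M past_field"
    by (rule measurable_into_past_fieldI) (rule measurable_past_process)
  have gp_F: "(\<lambda>\<omega>. g (path \<omega>)) \<in> borel_measurable ?F"
    by (rule measurable_compose[OF path_F g])
  have gp_M: "(\<lambda>\<omega>. g (path \<omega>)) \<in> borel_measurable M"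
    by (rule measurable_from_subalg[OF subalgebra_past_algebra gp_F])
  note [measurable] = law.measurable_from_past[OF g]
  have "AE \<omega> in M. real_cond_exp M ?F (\<lambda>\<omega>. \<phi> (X 0 \<omega>)) \<omega> = g (path \<omega>)"
  proof (rule real_cond_exp_charact)
    show "integrable M (\<lambda>\<omega>. \<phi> (X 0 \<omega>))"
      using bound by (intro integrable_const_bound[where B=C]) auto
    show "integrable M (\<lambda>\<omega>. g (path \<omega>))"
      using g_bound by (intro integrable_const_bound[where B=C] gp_M) auto
    fix A assume "A \<in> sets ?F"
    then obtain A' where A': "A' \<in> sets past_field" "A = path -` A' \<inter> space M"
      by (rule past_algebra_set_eq)
    have [measurable]: "A' \<in> sets (law M X)"
      using A'(1) law.subalgebra_past by (auto simp: subalgebra_def)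
    have ind: "indicator A \<omega> = (indicator A' (path \<omega>) :: real)" if "\<omega> \<in> space M" for \<omega>
      using that A'(2) by (simp add: indicator_def)
    have "(\<integral>\<omega>\<in>A. \<phi> (X 0 \<omega>) \<partial>M) = (\<integral>\<omega>. \<phi> (X 0 \<omega>) * indicator A' (path \<omega>) \<partial>M)"
      unfolding set_lebesgue_integral_def
      by (intro Bochner_Integration.integral_cong refl) (simp add: ind)
    also have "\<dots> = (\<integral>x. \<phi> (x 0) * indicator A' x \<partial>law M X)"
      by (rule integral_law[symmetric]) measurable
    also have "\<dots> = (\<integral>x. g x * indicator A' x \<partial>law M X)"
      using A'(1) by (intro predictor[of _ 1]) (auto simp: indicator_def)
    also have "\<dots> = (\<integral>\<omega>. g (path \<omega>) * indicator A' (path \<omega>) \<partial>M)"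
      by (rule integral_law) measurable
    also have "\<dots> = (\<integral>\<omega>\<in>A. g (path \<omega>) \<partial>M)"
      unfolding set_lebesgue_integral_def
      by (intro Bochner_Integration.integral_cong refl) (simp add: ind)
    finally show "(\<integral>\<omega>\<in>A. \<phi> (X 0 \<omega>) \<partial>M) = (\<integral>\<omega>\<in>A. g (path \<omega>) \<partial>M)" .
  qed (rule gp_F)
  with regular_cond_distr_integral(2)[OF prob_space_axioms subalgebra_past_algebra measurable_X K \<phi> bound]
  show ?thesis by eventually_elim simp
qed

lemma tendsto_L1_of_law:
  assumes lim: "tendsto_L1 (law M X) f g"
    and g'[measurable]: "g' \<in> borel_measurable M" and ae: "AE \<omega> in M. g' \<omega> = g (path \<omega>)"
  shows "tendsto_L1 M (\<lambda>n \<omega>. f n (path \<omega>)) g'"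
proof -
  have int: "integrable (law M X) (f n)" "integrable (law M X) g" for n
    using lim by (auto simp: tendsto_L1_def)
  have fp: "integrable M (\<lambda>\<omega>. f n (path \<omega>))" and gp: "integrable M (\<lambda>\<omega>. g (path \<omega>))" for n
    using int unfolding law_def by (auto intro: integrable_distr[OF measurable_path])
  have eq: "(\<integral>x. \<bar>f n x - g x\<bar> \<partial>law M X) = (\<integral>\<omega>. \<bar>f n (path \<omega>) - g' \<omega>\<bar> \<partial>M)" for n
  proof -
    have "(\<integral>x. \<bar>f n x - g x\<bar> \<partial>law M X) = (\<integral>\<omega>. \<bar>f n (path \<omega>) - g (path \<omega>)\<bar> \<partial>M)"
      using int by (intro integral_law) auto
    also have "\<dots> = (\<integral>\<omega>. \<bar>f n (path \<omega>) - g' \<omega>\<bar> \<partial>M)"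
      using ae fp gp by (intro integral_cong_AE) (auto elim!: eventually_mono)
    finally show ?thesis .
  qed
  have "integrable M g'"
    using gp ae by (subst integrable_cong_AE[where g="\<lambda>\<omega>. g (path \<omega>)"]) auto
  then show ?thesis using lim fp unfolding tendsto_L1_def eq by simp
qed

end

theorem theorem4:
  fixes M :: "'a measure"
    and X :: "int \<Rightarrow> 'a \<Rightarrow> real"
    and K :: "'a \<Rightarrow> real measure"
    and \<B> :: "nat \<Rightarrow> real set set"
    and l J k :: "nat \<Rightarrow> nat"
    and \<epsilon> :: "nat \<Rightarrow> real"
    and Q :: "real measure"
  assumes "stationary_ergodic M X"
    and "regular_cond_distr M (past_algebra M X) (X 0) K"
    and "\<And>i. i \<ge> 1 \<Longrightarrow> finite_interval_field (\<B> i)"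
    and "mono_on {1..} \<B>"
    and "sigma_sets UNIV (\<Union>i\<in>{1..}. \<B> i) = sets borel"
    and "\<And>i. i \<ge> 1 \<Longrightarrow> l i \<ge> 1" "mono_on {1..} l" "\<not> bdd_above (l ` {1..})"
    and "\<And>i. i \<ge> 1 \<Longrightarrow> J i \<ge> 1" "mono_on {1..} J" "\<not> bdd_above (J ` {1..})"
    and "\<And>n. k n \<ge> 1" "mono k" "\<not> bdd_above (range k)"
    and "\<And>i. i \<ge> 1 \<Longrightarrow> \<epsilon> i > 0" "\<epsilon> \<longlonglongrightarrow> 0"
    and "eventually (\<lambda>n. real n \<ge> real (l (k n)) +
           real (J (k n)) * real (card (atoms (\<B> (k n)))) ^ l (k n) / \<epsilon> (k n)) sequentially"
    and "prob_space Q" "sets Q = sets borel"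
  shows "(\<lambda>n. measure M {\<omega> \<in> space M.
            memory_length (\<B> (k n)) (l (k n)) (J (k n)) (\<lambda>t. X t \<omega>) \<le> enat n}) \<longlonglongrightarrow> 1 \<and>
         (\<forall>B \<in> (\<Union>i\<in>{1..}. \<B> i).
           tendsto_L1 M
             (\<lambda>n \<omega>. measure (truncated_estimate \<B> l J k Q n (\<lambda>t. X t \<omega>)) B)
             (\<lambda>\<omega>. measure (K \<omega>) B)) \<and>
         (\<forall>h :: real \<Rightarrow> real. continuous_on UNIV h \<longrightarrow> bounded (range h) \<longrightarrow>
           tendsto_L1 M
             (\<lambda>n \<omega>. \<integral>x. h x \<partial>truncated_estimate \<B> l J k Q n (\<lambda>t. X t \<omega>))
             (\<lambda>\<omega>. \<integral>x. h x \<partial>K \<omega>))"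
proof (intro conjI ballI allI impI)
  interpret M: stationary_process M X
    using assms(1) by (simp add: stationary_ergodic_def stationary_process_def stationary_process_axioms_def)
  have fields: "sigma_algebra UNIV (\<B> i)" "finite (\<B> i)" if "i \<ge> 1" for i
    using assms(3)[OF that] sigma_algebra_sigma_sets[of _ UNIV] by (auto simp: finite_interval_field_def)
  interpret S: forecasting_scheme "law M X" \<B> l J k \<epsilon> Q
    by (intro forecasting_scheme.intro forecasting_scheme_axioms.intro M.stationary_path_measure_law)
      (use assms fields in auto)
  show "(\<lambda>n. measure M {\<omega> \<in> space M.
      memory_length (\<B> (k n)) (l (k n)) (J (k n)) (\<lambda>t. X t \<omega>) \<le> enat n}) \<longlonglongrightarrow> 1"
  proof -
    have "measure M {\<omega> \<in> space M. memory_length (\<B> (k n)) (l (k n)) (J (k n)) (\<lambda>t. X t \<omega>) \<le> enat n}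
        = 1 - measure (law M X) (S.failure n)" for n
    proof -
      have "measure M {\<omega> \<in> space M. memory_length (\<B> (k n)) (l (k n)) (J (k n)) (\<lambda>t. X t \<omega>) \<le> enat n}
          = measure (law M X) (space (law M X) - S.failure n)"
        unfolding law_def
        by (subst measure_distr) (use sets.compl_sets[OF S.failure_sets[of n]] in \<open>auto simp: M.law.sets_eq vimage_def Int_def conj_commute\<close>)
      then show ?thesis by (simp only: M.law.prob_compl[OF S.failure_sets])
    qed
    then show ?thesis
      using tendsto_diff[OF tendsto_const S.prob_failure_tendsto_0, of 1] by simp
  qed
  have K_F: "K \<in> past_algebra M X \<rightarrow>\<^sub>M prob_algebra borel"
    using assms(2) by (simp add: regular_cond_distr_def)
  have main: "tendsto_L1 M (\<lambda>n \<omega>. \<integral>x. \<phi> x \<partial>truncated_estimate \<B> l J k Q n (\<lambda>t. X t \<omega>)) (\<lambda>\<omega>. \<integral>x. \<phi> x \<partial>K \<omega>)"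
    if \<phi>: "\<phi> \<in> borel_measurable borel" "\<And>y. \<bar>\<phi> y\<bar> \<le> C" for \<phi> :: "real \<Rightarrow> real" and C
  proof (rule M.law.bounded_predictor[OF \<phi>])
    fix g assume g: "g \<in> borel_measurable past_field" "\<And>x. \<bar>g x\<bar> \<le> C"
      "\<And>Z c. Z \<in> borel_measurable past_field \<Longrightarrow> (\<And>x. \<bar>Z x\<bar> \<le> c) \<Longrightarrow>
        (\<integral>x. \<phi> (x 0) * Z x \<partial>law M X) = (\<integral>x. g x * Z x \<partial>law M X)"
    show ?thesis
    proof (rule M.tendsto_L1_of_law[OF S.truncated_estimate_tendsto_L1[OF \<phi> g]])
      show "(\<lambda>\<omega>. \<integral>x. \<phi> x \<partial>K \<omega>) \<in> borel_measurable M"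
        by (rule measurable_from_subalg[OF M.subalgebra_past_algebra
            regular_cond_distr_integral(1)[OF M.prob_space_axioms M.subalgebra_past_algebra M.measurable_X assms(2) \<phi>]])
      show "AE \<omega> in M. (\<integral>x. \<phi> x \<partial>K \<omega>) = g (\<lambda>t. X t \<omega>)"
        by (rule M.predictor_eq_cond_integral[OF assms(2) \<phi> g])
    qed
  qed
  show "tendsto_L1 M (\<lambda>n \<omega>. measure (truncated_estimate \<B> l J k Q n (\<lambda>t. X t \<omega>)) B) (\<lambda>\<omega>. measure (K \<omega>) B)"
    if B: "B \<in> (\<Union>i\<in>{1..}. \<B> i)" for B
  proof -
    have [measurable]: "B \<in> sets borel" using B assms(5) by (metis sigma_sets.Basic)
    have est: "measure (truncated_estimate \<B> l J k Q n x) B = (\<integral>y. indicator B y \<partial>truncated_estimate \<B> l J k Q n x)" for n x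
    proof -
      have "space (truncated_estimate \<B> l J k Q n x) = UNIV"
        using sets_eq_imp_space_eq[OF assms(19)]
        by (simp add: truncated_estimate_def recurrence_estimate_def empirical_distr_def)
      then show ?thesis by simp
    qed
    have lim: "tendsto_L1 M (\<lambda>n \<omega>. measure (truncated_estimate \<B> l J k Q n (\<lambda>t. X t \<omega>)) B) (\<lambda>\<omega>. \<integral>y. indicator B y \<partial>K \<omega>)"
      unfolding est by (rule main[of _ 1]) (auto simp: indicator_def)
    have "(\<integral>y. indicator B y \<partial>K \<omega>) = measure (K \<omega>) B" if "\<omega> \<in> space M" for \<omega>
    proof -
      have "sets (K \<omega>) = sets borel"
        using measurable_space[OF K_F, of \<omega>] that by (auto simp: space_prob_algebra past_algebra_def)
      then have "space (K \<omega>) = UNIV" using sets_eq_imp_space_eq by fastforce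
      then show ?thesis by simp
    qed
    then show ?thesis
      using lim unfolding tendsto_L1_def
      by (simp cong: Bochner_Integration.integrable_cong Bochner_Integration.integral_cong)
  qed
  show "tendsto_L1 M (\<lambda>n \<omega>. \<integral>x. h x \<partial>truncated_estimate \<B> l J k Q n (\<lambda>t. X t \<omega>)) (\<lambda>\<omega>. \<integral>x. h x \<partial>K \<omega>)"
    if "continuous_on UNIV h" "bounded (range h)" for h :: "real \<Rightarrow> real"
  proof -
    obtain C where "\<And>y. \<bar>h y\<bar> \<le> C"
      using \<open>bounded (range h)\<close> unfolding bounded_iff by auto
    then show ?thesis
      using borel_measurable_continuous_onI[OF \<open>continuous_on UNIV h\<close>] by (intro main)
  qed
qed

end
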